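(* Let $X$ be an irreducible (two-sided) shift of finite type, $Y$ a (two-sided) subshift, $\pi : X \to Y$ a factor map given by a one-block map, and $f \in C(X)$. Then for each $\nu \in M(Y)$ we have $P(\pi,f)(y) = \Psi_f(y) = \widetilde{\Psi}_f(y)$ for $\nu$-almost every $y\in Y$, and hence $$\int_Y P(\pi, f)\, d\nu = \int_Y \Psi_f \, d\nu = \int_Y \widetilde{\Psi}_f\, d\nu .$$
   Context: Subshifts are over finite alphabets, indexed by $\mathbb{Z}$, with shift map $\sigma$ and the usual metric $\rho$ (so that $\rho(z,x)<2^{-p}$ is equivalent to $z_{[-p,p]}=x_{[-p,p]}$). $C(X)$ is the space of real-valued continuous functions on $X$. $M(Y)$ is the set of $\sigma$-invariant Borel probability measures on $Y$. A factor map $\pi:X\to Y$ is a continuous surjection with $\pi\circ\sigma=\sigma\circ\pi$. It is given by a one-block map if there is a map (also denoted $\pi$) from symbols of $X$ to symbols of $Y$ with $(\pi x)_i=\pi(x_i)$ for all $i$; for a block $B=b_1\cdots b_n$ of $X$ write $\pi(B)=\pi(b_1)\cdots\pi(b_n)$. $\mathcal{B}_n(X)$ denotes the set of $n$-blocks occurring in $X$, and $[b_1\cdots b_n]=\{x\in X: x_0=b_1,\dots,x_{n-1}=b_n\}$. Relative pressure function: for $\delta>0$, $n\ge1$, $y\in Y$ let $$P_n(\pi,f,\delta)(y)=\sup\Big\{\sum_{x\in E}\exp\Big(\sum_{i=0}^{n-1}f(\sigma^i x)\Big) : E \text{ is an } (n,\delta)\text{-separated subset of } X \text{ contained in } \pi^{-1}\{y\}\Big\},$$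 and $$P(\pi,f)(y)=\lim_{\delta\to0}\limsup_{n\to\infty}\frac1n\ln P_n(\pi,f,\delta)(y).$$ Here a set $E$ is $(n,\delta)$-separated if $\max_{0\le i<n}\rho(\sigma^i x,\sigma^i x')>\delta$ for all distinct $x,x'\in E$. Finite-range versions: for $n\ge1$, $0\le i\le n-1$ and $B=b_1\cdots b_n\in\mathcal{B}_n(X)$ let $$F_n^i(B)=\inf\{\exp(f(x)) : x\in X,\ \sigma^{-i}x\in[b_1\cdots b_n]\},\qquad \widetilde F_n^i(B)=\sup\{\exp(f(x)) : x\in X,\ \sigma^{-i}x\in[b_1\cdots b_n]\}.$$ Put $s_f(B)=\prod_{i=0}^{n-1}F_n^i(B)$ and $\widetilde s_f(B)=\prod_{i=0}^{n-1}\widetilde F_n^i(B)$. For $C\in\mathcal{B}_n(Y)$ put $S_f(C)=\sum_{B\in\mathcal{B}_n(X),\,\pi(B)=C}s_f(B)$ and $\widetilde S_f(C)=\sum_{B\in\mathcal{B}_n(X),\,\pi(B)=C}\widetilde s_f(B)$. For $y\in Y$ define $$\Psi_f(y)=\limsup_{n\to\infty}\frac1n\ln S_f(y_0y_1\cdots y_{n-1}),\qquad \widetilde\Psi_f(y)=\limsup_{n\to\infty}\frac1n\ln\widetilde S_f(y_0y_1\cdots y_{n-1}).$$ *)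

theory Defs
  imports "HOL-Probability.Probability"
begin

text \<open>
  Bi-infinite sequences are functions \<open>int \<Rightarrow> 'a\<close> with \<open>'a\<close> discrete, so that \<open>open\<close>, \<open>closed\<close>,
  \<open>continuous_on\<close> and \<open>borel\<close> refer to the product topology. Lemma \<open>open_iff_seq_dist\<close> below
  shows that this is the topology of the metric \<open>seq_dist\<close>. That metric is kept separate from the
  library's \<open>dist\<close> on countable products, which is normalised differently.
\<close>

definition shift_pow :: "int \<Rightarrow> (int \<Rightarrow> 'a) \<Rightarrow> int \<Rightarrow> 'a" where
  "shift_pow m x = (\<lambda>k. x (k + m))"

abbreviation shift :: "(int \<Rightarrow> 'a) \<Rightarrow> int \<Rightarrow> 'a" where
  "shift \<equiv> shift_pow 1"

lemma shift_pow_of_nat: "(shift_pow (int n) :: (int \<Rightarrow> 'a) \<Rightarrow> _) = shift ^^ n"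
proof (induction n)
  case 0
  show ?case by (auto simp: shift_pow_def)
next
  case (Suc n)
  have "shift_pow (int (Suc n)) x = shift (shift_pow (int n) x)" for x :: "int \<Rightarrow> 'a"
    by (simp add: shift_pow_def add.commute add.left_commute)
  then show ?case using Suc by auto
qed

lemma shift_pow_uminus: "shift_pow (- m) (shift_pow m x) = x" "shift_pow m (shift_pow (- m) x) = x"
  by (simp_all add: shift_pow_def)

definition seq_dist :: "(int \<Rightarrow> 'a) \<Rightarrow> (int \<Rightarrow> 'a) \<Rightarrow> real" where
  "seq_dist x y = (if x = y then 0 else (1/2) ^ (LEAST k. \<exists>i. \<bar>i\<bar> = int k \<and> x i \<noteq> y i))"

lemma seq_dist_less_iff:
  "seq_dist z x < (1/2) ^ p \<longleftrightarrow> (\<forall>i\<in>{- int p..int p}. z i = x i)"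
proof (cases "z = x")
  case True
  then show ?thesis by (simp add: seq_dist_def)
next
  case False
  let ?P = "\<lambda>k. \<exists>i. \<bar>i\<bar> = int k \<and> z i \<noteq> x i"
  define K where "K = (LEAST k. ?P k)"
  from False obtain j where "z j \<noteq> x j" by auto
  then have "?P (nat \<bar>j\<bar>)" by auto
  then have K: "?P K" unfolding K_def by (rule LeastI)
  have least: "K \<le> k" if "?P k" for k unfolding K_def using that by (rule Least_le)
  have "seq_dist z x < (1/2) ^ p \<longleftrightarrow> p < K"
    using False by (simp add: seq_dist_def K_def [symmetric] power_strict_decreasing_iff)
  also have "\<dots> \<longleftrightarrow> (\<forall>i\<in>{- int p..int p}. z i = x i)"
  proof
    assume "p < K"
    show "\<forall>i\<in>{- int p..int p}. z i = x i"
    proof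
      fix i assume "i \<in> {- int p..int p}"
      then have "nat \<bar>i\<bar> \<le> p" by auto
      then show "z i = x i" using least [of "nat \<bar>i\<bar>"] \<open>p < K\<close> by fastforce
    qed
  next
    assume "\<forall>i\<in>{- int p..int p}. z i = x i"
    then show "p < K" using K by (force simp: not_less [symmetric])
  qed
  finally show ?thesis .
qed

lemma open_iff_seq_dist:
  fixes U :: "(int \<Rightarrow> 'a::discrete_topology) set"
  shows "open U \<longleftrightarrow> (\<forall>x\<in>U. \<exists>e>0. \<forall>z. seq_dist z x < e \<longrightarrow> z \<in> U)"
proof
  assume U: "open U"
  show "\<forall>x\<in>U. \<exists>e>0. \<forall>z. seq_dist z x < e \<longrightarrow> z \<in> U"
  proof
    fix x assume "x \<in> U"
    then obtain V where V: "finite {i. V i \<noteq> UNIV}" "x \<in> Pi\<^sub>E UNIV V" "Pi\<^sub>E UNIV V \<subseteq> U"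
      using U unfolding open_fun_def openin_product_topology_alt by (auto simp: Ball_def)
    obtain p where p: "\<And>i. V i \<noteq> UNIV \<Longrightarrow> nat \<bar>i\<bar> \<le> p"
      using finite_nat_set_iff_bounded_le [of "(\<lambda>i. nat \<bar>i\<bar>) ` {i. V i \<noteq> UNIV}"] V(1) by auto
    have "z \<in> U" if "seq_dist z x < (1/2) ^ p" for z
    proof -
      have eq: "z i = x i" if "nat \<bar>i\<bar> \<le> p" for i
      proof -
        have "i \<in> {- int p..int p}" using that by auto
        then show ?thesis using \<open>seq_dist z x < (1/2) ^ p\<close> by (simp add: seq_dist_less_iff)
      qed
      have "z i \<in> V i" for i
        using V(2) eq [of i] p [of i] by (cases "V i = UNIV") (auto simp: PiE_iff)
      then show ?thesis using V(3) by auto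
    qed
    then show "\<exists>e>0. \<forall>z. seq_dist z x < e \<longrightarrow> z \<in> U"
      by (intro exI [of _ "(1/2) ^ p"]) auto
  qed
next
  assume R: "\<forall>x\<in>U. \<exists>e>0. \<forall>z. seq_dist z x < e \<longrightarrow> z \<in> U"
  show "open U"
  proof (unfold open_subopen [of U], intro ballI)
    fix x assume "x \<in> U"
    then obtain e where e: "e > 0" "\<And>z. seq_dist z x < e \<Longrightarrow> z \<in> U" using R by blast
    obtain p where p: "(1/2) ^ p < e" using real_arch_pow_inv [of e "1/2"] e(1) by auto
    define T where "T = Pi\<^sub>E UNIV (\<lambda>i. if i \<in> {- int p..int p} then {x i} else UNIV)"
    have "{i. (if i \<in> {- int p..int p} then {x i} else UNIV) \<noteq> UNIV} \<subseteq> {- int p..int p}"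
      by (auto split: if_splits)
    then have "finite {i. (if i \<in> {- int p..int p} then {x i} else UNIV) \<noteq> UNIV}"
      by (rule finite_subset) simp
    then have "open T" unfolding T_def
      by (intro open_PiE) (auto simp: discrete_topology_class.open_discrete)
    moreover have "x \<in> T" by (auto simp: T_def)
    moreover have "T \<subseteq> U"
    proof
      fix z assume "z \<in> T"
      then have "z i \<in> (if i \<in> {- int p..int p} then {x i} else UNIV)" for i
        unfolding T_def by (rule PiE_mem) simp
      then have "\<forall>i\<in>{- int p..int p}. z i = x i" by (metis singletonD)
      then have "seq_dist z x < e" using p by (auto simp: seq_dist_less_iff [symmetric])
      then show "z \<in> U" by (rule e(2))
    qed
    ultimately show "\<exists>T. open T \<and> x \<in> T \<and> T \<subseteq> U" by blast
  qed
qed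

definition subshift :: "'a::discrete_topology set \<Rightarrow> (int \<Rightarrow> 'a) set \<Rightarrow> bool" where
  "subshift A X \<longleftrightarrow> finite A \<and> (\<forall>x\<in>X. range x \<subseteq> A) \<and> closed X \<and> shift ` X = X"

definition block :: "(int \<Rightarrow> 'a) \<Rightarrow> int \<Rightarrow> nat \<Rightarrow> 'a list" where
  "block x i n = map (\<lambda>k. x (i + int k)) [0..<n]"

definition occurs :: "'a list \<Rightarrow> (int \<Rightarrow> 'a) \<Rightarrow> bool" where
  "occurs w x \<longleftrightarrow> (\<exists>i. block x i (length w) = w)"

definition blocks :: "(int \<Rightarrow> 'a) set \<Rightarrow> nat \<Rightarrow> 'a list set" where
  "blocks X n = {w. length w = n \<and> (\<exists>x\<in>X. occurs w x)}"

definition cylinder :: "(int \<Rightarrow> 'a) set \<Rightarrow> 'a list \<Rightarrow> (int \<Rightarrow> 'a) set" where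
  "cylinder X w = {x \<in> X. block x 0 (length w) = w}"

definition shift_of_finite_type :: "'a::discrete_topology set \<Rightarrow> (int \<Rightarrow> 'a) set \<Rightarrow> bool" where
  "shift_of_finite_type A X \<longleftrightarrow> finite A \<and>
     (\<exists>F. finite F \<and> X = {x. range x \<subseteq> A \<and> (\<forall>w\<in>F. \<not> occurs w x)})"

definition irreducible_shift :: "(int \<Rightarrow> 'a) set \<Rightarrow> bool" where
  "irreducible_shift X \<longleftrightarrow>
     (\<forall>u\<in>(\<Union>n. blocks X n). \<forall>v\<in>(\<Union>n. blocks X n). \<exists>w. u @ w @ v \<in> (\<Union>n. blocks X n))"

definition factor_map ::
    "(int \<Rightarrow> 'a::discrete_topology) set \<Rightarrow> (int \<Rightarrow> 'b::discrete_topology) set \<Rightarrow>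
      ((int \<Rightarrow> 'a) \<Rightarrow> int \<Rightarrow> 'b) \<Rightarrow> bool" where
  "factor_map X Y \<pi> \<longleftrightarrow>
     continuous_on X \<pi> \<and> \<pi> ` X = Y \<and> (\<forall>x\<in>X. \<pi> (shift x) = shift (\<pi> x))"

definition one_block_map ::
    "(int \<Rightarrow> 'a) set \<Rightarrow> ((int \<Rightarrow> 'a) \<Rightarrow> int \<Rightarrow> 'b) \<Rightarrow> ('a \<Rightarrow> 'b) \<Rightarrow> bool" where
  "one_block_map X \<pi> p \<longleftrightarrow> (\<forall>x\<in>X. \<forall>i. \<pi> x i = p (x i))"

definition invariant_measures :: "(int \<Rightarrow> 'a::discrete_topology) set \<Rightarrow> (int \<Rightarrow> 'a) measure set" where
  "invariant_measures Y = {\<nu>. prob_space \<nu> \<and> sets \<nu> = sets (restrict_space borel Y) \<and>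
     shift \<in> measurable \<nu> \<nu> \<and> distr \<nu> \<nu> shift = \<nu>}"

definition separated :: "nat \<Rightarrow> real \<Rightarrow> (int \<Rightarrow> 'a) set \<Rightarrow> bool" where
  "separated n \<delta> E \<longleftrightarrow> (\<forall>x\<in>E. \<forall>x'\<in>E. x \<noteq> x' \<longrightarrow>
     Max ((\<lambda>i. seq_dist (shift_pow (int i) x) (shift_pow (int i) x')) ` {..<n}) > \<delta>)"

text \<open>
  If \<open>X\<close> is a subshift, \<open>n \<ge> 1\<close> and \<open>\<delta> > 0\<close>, then by compactness separated subsets of \<open>X\<close> are
  finite, with a common bound on their size, so the sums and the real supremum are the genuine
  ones. The index \<open>n = 0\<close> is irrelevant, here and below, because only the upper limit is used.
\<close>

definition pressure_n ::
    "(int \<Rightarrow> 'a) set \<Rightarrow> ((int \<Rightarrow> 'a) \<Rightarrow> int \<Rightarrow> 'b) \<Rightarrow> ((int \<Rightarrow> 'a) \<Rightarrow> real) \<Rightarrow>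
      nat \<Rightarrow> real \<Rightarrow> (int \<Rightarrow> 'b) \<Rightarrow> real" where
  "pressure_n X \<pi> f n \<delta> y =
     (SUP E \<in> {E. separated n \<delta> E \<and> E \<subseteq> {x \<in> X. \<pi> x = y}}.
        \<Sum>x\<in>E. exp (\<Sum>i<n. f (shift_pow (int i) x)))"

definition rel_pressure ::
    "(int \<Rightarrow> 'a) set \<Rightarrow> ((int \<Rightarrow> 'a) \<Rightarrow> int \<Rightarrow> 'b) \<Rightarrow> ((int \<Rightarrow> 'a) \<Rightarrow> real) \<Rightarrow>
      (int \<Rightarrow> 'b) \<Rightarrow> ereal" where
  "rel_pressure X \<pi> f y =
     Lim (at_right 0) (\<lambda>\<delta>. limsup (\<lambda>n. ereal (1 / real n * ln (pressure_n X \<pi> f n \<delta> y))))"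

definition F_inf :: "(int \<Rightarrow> 'a) set \<Rightarrow> ((int \<Rightarrow> 'a) \<Rightarrow> real) \<Rightarrow> nat \<Rightarrow> 'a list \<Rightarrow> real" where
  "F_inf X f i B = Inf {exp (f x) | x. x \<in> X \<and> shift_pow (- int i) x \<in> cylinder X B}"

definition F_sup :: "(int \<Rightarrow> 'a) set \<Rightarrow> ((int \<Rightarrow> 'a) \<Rightarrow> real) \<Rightarrow> nat \<Rightarrow> 'a list \<Rightarrow> real" where
  "F_sup X f i B = Sup {exp (f x) | x. x \<in> X \<and> shift_pow (- int i) x \<in> cylinder X B}"

definition s_inf :: "(int \<Rightarrow> 'a) set \<Rightarrow> ((int \<Rightarrow> 'a) \<Rightarrow> real) \<Rightarrow> 'a list \<Rightarrow> real" where
  "s_inf X f B = (\<Prod>i<length B. F_inf X f i B)"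

definition s_sup :: "(int \<Rightarrow> 'a) set \<Rightarrow> ((int \<Rightarrow> 'a) \<Rightarrow> real) \<Rightarrow> 'a list \<Rightarrow> real" where
  "s_sup X f B = (\<Prod>i<length B. F_sup X f i B)"

definition S_inf ::
    "(int \<Rightarrow> 'a) set \<Rightarrow> ('a \<Rightarrow> 'b) \<Rightarrow> ((int \<Rightarrow> 'a) \<Rightarrow> real) \<Rightarrow> 'b list \<Rightarrow> real" where
  "S_inf X p f C = (\<Sum>B \<in> {B \<in> blocks X (length C). map p B = C}. s_inf X f B)"

definition S_sup ::
    "(int \<Rightarrow> 'a) set \<Rightarrow> ('a \<Rightarrow> 'b) \<Rightarrow> ((int \<Rightarrow> 'a) \<Rightarrow> real) \<Rightarrow> 'b list \<Rightarrow> real" where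
  "S_sup X p f C = (\<Sum>B \<in> {B \<in> blocks X (length C). map p B = C}. s_sup X f B)"

definition Psi_inf ::
    "(int \<Rightarrow> 'a) set \<Rightarrow> ('a \<Rightarrow> 'b) \<Rightarrow> ((int \<Rightarrow> 'a) \<Rightarrow> real) \<Rightarrow> (int \<Rightarrow> 'b) \<Rightarrow> ereal" where
  "Psi_inf X p f y = limsup (\<lambda>n. ereal (1 / real n * ln (S_inf X p f (block y 0 n))))"

definition Psi_sup ::
    "(int \<Rightarrow> 'a) set \<Rightarrow> ('a \<Rightarrow> 'b) \<Rightarrow> ((int \<Rightarrow> 'a) \<Rightarrow> real) \<Rightarrow> (int \<Rightarrow> 'b) \<Rightarrow> ereal" where
  "Psi_sup X p f y = limsup (\<lambda>n. ereal (1 / real n * ln (S_sup X p f (block y 0 n))))"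

end

theory Submission
  imports Defs
begin

text \<open>
  Write \<open>\<phi>\<^sub>n y\<close>, \<open>\<phi>\<^sup>k\<^sub>n y\<close> and \<open>\<psi>\<^sub>n y\<close> for the logarithm of the sum of the weights \<open>s_sup\<close> over those blocks
  at the coordinates \<open>0,\<dots>,n-1\<close> of points of \<open>X\<close> that project to \<open>y\<close> on \<open>[0,n)\<close>, on \<open>[-k,n+k)\<close>,
  and everywhere. Uniform continuity of \<open>f\<close> makes \<open>s_sup\<close> and \<open>s_inf\<close> agree up to a factor \<open>e\<^sup>o\<^sup>(\<^sup>n\<^sup>)\<close>,
  so at every point of \<open>Y\<close> both \<open>Psi\<close> functions are the exponential growth rate of \<open>\<phi>\<^sub>n\<close>, while
  the relative pressure is that of \<open>\<psi>\<^sub>n \<le> \<phi>\<^sub>n\<close>.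

  Cutting a long block gives \<open>\<phi>\<^sub>N \<le> \<Sum>\<^sub>l \<phi>\<^sup>k\<^sub>n \<circ> \<sigma>\<^bsup>k + l n\<^esup> + O(1)\<close>. By the maximal ergodic theorem for
  \<open>\<sigma>\<^sup>n\<close>, \<open>\<integral> limsup \<phi>\<^sub>N / N \<le> \<integral> \<phi>\<^sup>k\<^sub>n / n\<close> for all \<open>k\<close> and \<open>n\<close>. As \<open>k \<rightarrow> \<infinity>\<close> compactness gives
  \<open>\<phi>\<^sup>k\<^sub>n \<rightarrow> \<psi>\<^sub>n\<close>, and the reverse Fatou lemma yields \<open>\<integral> limsup \<phi>\<^sub>n / n \<le> \<integral> limsup \<psi>\<^sub>n / n\<close>.
  Since \<open>\<psi>\<^sub>n \<le> \<phi>\<^sub>n\<close>, the two upper limits agree almost everywhere.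
\<close>

section \<open>Upper limits of averages\<close>

text \<open>Dividing by \<open>n\<close> turns the error into \<open>e + c / n\<close>, and
  \<open>e\<close> is arbitrary. The constant \<open>c\<close> may depend on \<open>e\<close>, so
  errors of size o(n) do not change a growth rate.\<close>

lemma limsup_average_mono:
  fixes a b :: "nat \<Rightarrow> real"
  assumes "\<And>e. 0 < e \<Longrightarrow> \<exists>c. \<forall>\<^sub>F n in sequentially. a n \<le> b n + e * real n + c"
  shows "limsup (\<lambda>n. ereal (1 / real n * a n)) \<le> limsup (\<lambda>n. ereal (1 / real n * b n))"
proof (rule ereal_le_epsilon2)
  fix e :: real assume e: "0 < e"
  then obtain c where c: "\<forall>\<^sub>F n in sequentially. a n \<le> b n + e * real n + c"
    using assms by blast
  have "limsup (\<lambda>n. ereal (1 / real n * a n))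
      \<le> limsup (\<lambda>n. ereal (e + 1 / real n * c) + ereal (1 / real n * b n))"
  proof (rule Limsup_mono, use c eventually_gt_at_top[of 0] in eventually_elim)
    case (elim n)
    have "1 / real n * a n \<le> 1 / real n * (b n + e * real n + c)"
      using elim(1) by (intro mult_left_mono) auto
    also have "\<dots> = e + 1 / real n * c + 1 / real n * b n"
      using elim(2) by (simp add: field_simps)
    finally show ?case by simp
  qed
  also have "\<dots> = ereal e + limsup (\<lambda>n. ereal (1 / real n * b n))"
  proof (rule ereal_limsup_lim_add)
    have "(\<lambda>n. e + 1 / real n * c) \<longlonglongrightarrow> e + 0 * c"
      by (intro tendsto_intros lim_1_over_n)
    then show "(\<lambda>n. ereal (e + 1 / real n * c)) \<longlonglongrightarrow> ereal e" by simp
  qed simp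
  finally show "limsup (\<lambda>n. ereal (1 / real n * a n)) \<le> limsup (\<lambda>n. ereal (1 / real n * b n)) + ereal e"
    by (simp add: add.commute)
qed

lemma real_of_ereal_mono_finite:
  assumes "a \<le> b" "\<bar>a\<bar> \<noteq> \<infinity>" "\<bar>b\<bar> \<noteq> \<infinity>"
  shows "real_of_ereal a \<le> real_of_ereal b"
  using assms by (cases a; cases b) auto

text \<open>Upper limits live in \<open>ereal\<close> but are integrated as reals. Since
  \<open>real_of_ereal\<close> sends infinite values to 0, finiteness is what makes this passage
  faithful.\<close>

lemma limsup_bounded_real:
  fixes u :: "nat \<Rightarrow> real"
  assumes "\<forall>\<^sub>F n in sequentially. \<bar>u n\<bar> \<le> K"
  shows "\<bar>limsup (\<lambda>n. ereal (u n))\<bar> \<noteq> \<infinity>"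
    and "\<bar>real_of_ereal (limsup (\<lambda>n. ereal (u n)))\<bar> \<le> K"
proof -
  let ?L = "limsup (\<lambda>n. ereal (u n))"
  have "?L \<le> ereal K"
    by (rule Limsup_bounded, use assms in eventually_elim) auto
  moreover have "ereal (- K) \<le> ?L"
  proof -
    have "ereal (- K) \<le> liminf (\<lambda>n. ereal (u n))"
      by (rule Liminf_bounded, use assms in eventually_elim) auto
    then show ?thesis using Liminf_le_Limsup[of sequentially] order_trans by fastforce
  qed
  ultimately show "\<bar>?L\<bar> \<noteq> \<infinity>" "\<bar>real_of_ereal ?L\<bar> \<le> K"
    by (cases ?L; auto)+
qed

lemma average_bound:
  fixes a :: "nat \<Rightarrow> real"
  assumes "\<And>n. \<bar>a n\<bar> \<le> real n * K"
  shows "\<bar>1 / real n * a n\<bar> \<le> \<bar>K\<bar>"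
proof (cases "n = 0")
  case False
  have "\<bar>a n\<bar> \<le> real n * \<bar>K\<bar>"
    using assms[of n] by (smt (verit) mult_left_mono of_nat_0_le_iff)
  then show ?thesis using False by (simp add: abs_mult field_simps)
qed simp

lemma abs_sum_le_bound:
  fixes g :: "nat \<Rightarrow> real"
  assumes "\<And>i. \<bar>g i\<bar> \<le> K"
  shows "\<bar>\<Sum>i<n. g i\<bar> \<le> real n * K"
  using order_trans[OF sum_abs sum_bounded_above[of "{..<n}" "\<lambda>i. \<bar>g i\<bar>" K]] assms by simp

text \<open>Writing \<open>N = d + q * n + r\<close> with \<open>r < n\<close> gives one term of
  \<open>g\<close> for each full block of length \<open>n\<close>. The \<open>d + r\<close>
  remaining coordinates stay bounded in number and disappear after division by
  \<open>N\<close>.\<close>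

lemma limsup_block_average:
  fixes u g :: "nat \<Rightarrow> real"
  assumes n: "0 < n" and g: "\<And>l. \<bar>g l\<bar> \<le> K"
    and u: "\<And>q r. r < n \<Longrightarrow> u (d + q * n + r) \<le> real n * (\<Sum>l<q. g l) + c"
  shows "limsup (\<lambda>N. ereal (1 / real N * u N)) \<le> limsup (\<lambda>q. ereal (1 / real q * (\<Sum>l<q. g l)))"
proof -
  let ?S = "limsup (\<lambda>q. ereal (1 / real q * (\<Sum>l<q. g l)))"
  have "\<bar>\<Sum>l<q. g l\<bar> \<le> real q * K" for q
    using g by (rule abs_sum_le_bound)
  then have "\<bar>?S\<bar> \<noteq> \<infinity>"
    by (intro limsup_bounded_real(1)[of _ "\<bar>K\<bar>"] always_eventually allI average_bound)
  then obtain L where L: "?S = ereal L" by (cases ?S) auto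
  have "limsup (\<lambda>N. ereal (1 / real N * u N)) \<le> limsup (\<lambda>N. ereal (1 / real N * (real N * L)))"
  proof (rule limsup_average_mono)
    fix e :: real assume e: "0 < e"
    have "\<forall>\<^sub>F q in sequentially. ereal (1 / real q * (\<Sum>l<q. g l)) < ereal (L + e)"
      by (rule Limsup_lessD, unfold L) (use e in simp)
    then obtain Q where Q: "\<And>q. q \<ge> Q \<Longrightarrow> 1 / real q * (\<Sum>l<q. g l) < L + e"
      by (auto simp: eventually_sequentially)
    have "u N \<le> real N * L + e * real N + (\<bar>L + e\<bar> * real (d + n) + c)"
      if N: "N \<ge> d + (Q + 1) * n" for N
    proof -
      define q where "q = (N - d) div n"
      define r where "r = (N - d) mod n"
      have Nq: "N = d + q * n + r" and r: "r < n"
        using N n by (auto simp: q_def r_def)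
      \<comment> \<open>Using \<open>Q + 1\<close> instead of \<open>Q\<close> makes
        \<open>q\<close> positive, so the bound on the average can be multiplied by
        \<open>q\<close>.\<close>
      have "Q + 1 \<le> q"
        unfolding q_def using N n by (simp add: less_eq_div_iff_mult_less_eq)
      then have "(\<Sum>l<q. g l) \<le> real q * (L + e)"
        using Q[of q] by (simp add: field_simps)
      then have "u N \<le> real n * (real q * (L + e)) + c"
        using u[OF r, of q] Nq n by (smt (verit) mult_left_mono of_nat_0_le_iff)
      also have "real n * (real q * (L + e)) = real N * (L + e) - real (d + r) * (L + e)"
        by (simp add: Nq algebra_simps)
      finally have "u N \<le> real N * (L + e) - real (d + r) * (L + e) + c" .
      \<comment> \<open>The sign of \<open>L + e\<close> is unknown, hence the absolute value in the
        constant.\<close>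
      moreover have "- (real (d + r) * (L + e)) \<le> \<bar>L + e\<bar> * real (d + n)"
      proof -
        have "- (real (d + r) * (L + e)) \<le> real (d + r) * \<bar>L + e\<bar>"
          by (metis abs_ge_minus_self abs_mult abs_of_nat)
        also have "\<dots> \<le> real (d + n) * \<bar>L + e\<bar>"
          using r by (intro mult_right_mono) auto
        finally show ?thesis by (simp add: mult.commute)
      qed
      moreover have "real N * (L + e) = real N * L + e * real N" by (simp add: algebra_simps)
      ultimately show ?thesis by linarith
    qed
    then show "\<exists>c. \<forall>\<^sub>F N in sequentially. u N \<le> real N * L + e * real N + c"
      unfolding eventually_sequentially by blast
  qed
  also have "limsup (\<lambda>N. ereal (1 / real N * (real N * L))) = ereal L"
  proof (rule lim_imp_Limsup)
    show "(\<lambda>N. ereal (1 / real N * (real N * L))) \<longlonglongrightarrow> ereal L"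
      by (rule tendsto_eventually, use eventually_gt_at_top[of 0] in eventually_elim) auto
  qed simp
  finally show ?thesis using L by simp
qed

section \<open>An upper ergodic inequality\<close>

lemma distr_funpow_invariant:
  assumes "T \<in> measurable M M" "distr M M T = M"
  shows "T ^^ n \<in> measurable M M \<and> distr M M (T ^^ n) = M"
proof (induction n)
  case 0
  then show ?case by (simp add: id_def distr_id)
next
  case (Suc n)
  have "distr M M (T \<circ> (T ^^ n)) = distr (distr M M (T ^^ n)) M T"
    using Suc assms by (intro distr_distr[symmetric]) auto
  then show ?case using Suc assms measurable_comp[of "T ^^ n" M M T M]
    by (simp del: o_apply add: o_def[symmetric])
qed

text \<open>Garsia's argument: on \<open>{m N > 0}\<close> the running maximum \<open>m N\<close> of the partial sums
  satisfies \<open>m N \<le> h + m N \<circ> T\<close>, and the two integrals of \<open>m N\<close> cancel.\<close>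

lemma maximal_ergodic:
  fixes h :: "'a \<Rightarrow> real"
  assumes T: "T \<in> measurable M M" "distr M M T = M" and h: "integrable M h"
    and pos: "\<And>x. x \<in> space M \<Longrightarrow> \<exists>n. 0 < (\<Sum>i<n. h ((T ^^ i) x))"
  shows "0 \<le> (\<integral>x. h x \<partial>M)"
proof -
  \<comment> \<open>The recursion peels off the first summand: the maximum of the partial sums of
    lengths \<open>0\<close> to \<open>Suc N\<close> is 0 or \<open>h x\<close> plus the maximum for
    \<open>N\<close> at \<open>T x\<close>.\<close>
  define m where "m = rec_nat (\<lambda>x. 0) (\<lambda>_ k x. max 0 (h x + k (T x)))"
  have m0: "m 0 x = 0" and mS: "m (Suc N) x = max 0 (h x + m N (T x))" for N x
    by (simp_all add: m_def)
  have m_int: "integrable M (m N)" for N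
  proof (induction N)
    case 0
    then show ?case by (simp add: m_def)
  next
    case (Suc N)
    have "integrable M (\<lambda>x. m N (T x))"
      using Suc integrable_distr[OF T(1), of "m N"] T(2) by simp
    then show ?case using h by (simp add: m_def)
  qed
  have m_nonneg: "0 \<le> m N x" for N x by (cases N) (simp_all add: m0 mS)
  have m_mono: "m N x \<le> m (Suc N) x" for N x
  proof (induction N arbitrary: x)
    case 0
    then show ?case using m_nonneg by (simp add: m0)
  next
    case (Suc N)
    from Suc[of "T x"] show ?case by (simp add: mS[of "Suc N"] mS[of N] max_def)
  qed
  have m_incr: "incseq (\<lambda>N. m N x)" for x using m_mono by (rule incseq_SucI)
  have sum_le: "(\<Sum>i<n. h ((T ^^ i) x)) \<le> m n x" for n x
  proof (induction n arbitrary: x)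
    case (Suc n)
    have "(\<Sum>i<Suc n. h ((T ^^ i) x)) = h x + (\<Sum>i<n. h ((T ^^ i) (T x)))"
      by (subst sum.lessThan_Suc_shift) (simp add: funpow_swap1)
    also have "\<dots> \<le> h x + m n (T x)" using Suc by simp
    finally show ?case by (simp add: mS)
  qed (simp add: m0)
  define h' where "h' N x = (if 0 < m N x then h x else 0)" for N x
  have meas: "m N \<in> borel_measurable M" for N using m_int by auto
  have h'_meas: "h' N \<in> borel_measurable M" for N
    unfolding h'_def using meas h by measurable
  have h'_int: "integrable M (h' N)" for N
    by (rule Bochner_Integration.integrable_bound[OF h h'_meas]) (auto simp: h'_def)
  have step: "0 \<le> (\<integral>x. h' N x \<partial>M)" for N
  proof -
    have mT_int: "integrable M (\<lambda>x. m N (T x))"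
      using m_int[of N] integrable_distr[OF T(1), of "m N"] T(2) by simp
    have "(\<integral>x. m N (T x) \<partial>M) = (\<integral>x. m N x \<partial>M)"
      using integral_distr[OF T(1) meas, of N] T(2) by simp
    then have "0 = (\<integral>x. m N x - m N (T x) \<partial>M)"
      using mT_int m_int by simp
    also have "\<dots> \<le> (\<integral>x. h' N x \<partial>M)"
    proof (rule integral_mono[OF Bochner_Integration.integrable_diff[OF m_int mT_int] h'_int])
      fix x
      show "m N x - m N (T x) \<le> h' N x"
      proof (cases N)
        case (Suc k)
        have "m k (T x) \<le> m N (T x)" using m_mono Suc by simp
        then show ?thesis using Suc m_nonneg[of N "T x"] by (auto simp: h'_def mS max_def)
      qed (simp add: m0 h'_def)
    qed
    finally show ?thesis .
  qed
  \<comment> \<open>By \<open>pos\<close> the increasing sets where \<open>m N\<close> is positive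
    exhaust the space, so the truncations \<open>h' N\<close> converge to \<open>h\<close>
    pointwise, dominated by its absolute value.\<close>
  have "(\<lambda>N. \<integral>x. h' N x \<partial>M) \<longlonglongrightarrow> (\<integral>x. h x \<partial>M)"
  proof (rule integral_dominated_convergence[where w = "\<lambda>x. \<bar>h x\<bar>"])
    show "AE x in M. (\<lambda>N. h' N x) \<longlonglongrightarrow> h x"
    proof (rule AE_I2)
      fix x assume "x \<in> space M"
      then obtain n where "0 < (\<Sum>i<n. h ((T ^^ i) x))" using pos by blast
      then have "0 < m n x" using sum_le[of x n] by simp
      then have "h' N x = h x" if "n \<le> N" for N
        using incseqD[OF m_incr that, of x] by (simp add: h'_def)
      then show "(\<lambda>N. h' N x) \<longlonglongrightarrow> h x"
        by (intro tendsto_eventually) (auto simp: eventually_sequentially)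
    qed
  qed (use h h'_meas in \<open>simp_all, simp_all add: h'_def\<close>)
  then show ?thesis using step by (intro LIMSEQ_le_const) auto
qed

text \<open>The upper half of Birkhoff's theorem. \<open>maximal_ergodic\<close> applies to
  \<open>g - L + e\<close>: along an orbit \<open>L\<close> never exceeds its initial value, while
  some average of \<open>g\<close> exceeds \<open>L x - e\<close>. Then \<open>e\<close> tends to
  0.\<close>

lemma (in prob_space) integral_limsup_average_le:
  fixes g :: "'a \<Rightarrow> real"
  assumes T: "T \<in> measurable M M" "distr M M T = M"
    and g: "g \<in> borel_measurable M" "\<And>x. x \<in> space M \<Longrightarrow> \<bar>g x\<bar> \<le> K"
  defines "L \<equiv> \<lambda>x. real_of_ereal (limsup (\<lambda>n. ereal (1 / real n * (\<Sum>i<n. g ((T ^^ i) x)))))"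
  shows "integrable M L" and "(\<integral>x. L x \<partial>M) \<le> (\<integral>x. g x \<partial>M)"
proof -
  let ?S = "\<lambda>n x. \<Sum>i<n. g ((T ^^ i) x)"
  have Tn: "T ^^ n \<in> measurable M M" for n using distr_funpow_invariant[OF T] by blast
  have Tsp: "(T ^^ n) x \<in> space M" if "x \<in> space M" for n x
    using measurable_space[OF Tn that] .
  have S_bd: "\<bar>1 / real n * ?S n x\<bar> \<le> \<bar>K\<bar>" if "x \<in> space M" for n x
  proof (rule average_bound)
    fix n
    show "\<bar>?S n x\<bar> \<le> real n * K"
      using g(2) Tsp[OF that] by (intro abs_sum_le_bound) auto
  qed
  have L_ereal: "limsup (\<lambda>n. ereal (1 / real n * ?S n x)) = ereal (L x)"
    and L_bd: "\<bar>L x\<bar> \<le> \<bar>K\<bar>" if "x \<in> space M" for x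
    using limsup_bounded_real[of "\<lambda>n. 1 / real n * ?S n x" "\<bar>K\<bar>"] S_bd[OF that]
    by (auto simp: L_def ereal_real)
  have L_meas: "L \<in> borel_measurable M"
    unfolding L_def using g(1) Tn by measurable
  show L_int: "integrable M L"
    using L_bd by (intro integrable_const_bound[OF _ L_meas, of "\<bar>K\<bar>"]) auto
  have g_int: "integrable M g"
    using g by (intro integrable_const_bound[of _ K]) auto
  \<comment> \<open>The orbit sums at \<open>x\<close> and at \<open>T x\<close> differ only by a
    first and a last term, hence by at most \<open>2 * K\<close>.\<close>
  have L_T: "L (T x) \<le> L x" if x: "x \<in> space M" for x
  proof -
    have "limsup (\<lambda>n. ereal (1 / real n * ?S n (T x))) \<le> limsup (\<lambda>n. ereal (1 / real n * ?S n x))"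
    proof (rule limsup_average_mono)
      fix e :: real assume "0 < e"
      have "?S n (T x) \<le> ?S n x + e * real n + 2 * K" for n
      proof -
        have "?S n (T x) + g x = ?S (Suc n) x"
          by (subst sum.lessThan_Suc_shift) (simp add: funpow_swap1)
        also have "\<dots> = ?S n x + g ((T ^^ n) x)" by simp
        finally have "?S n (T x) \<le> ?S n x + 2 * K"
          using g(2)[OF x] g(2)[OF Tsp[OF x, of n]] by linarith
        moreover have "0 \<le> e * real n" using \<open>0 < e\<close> by simp
        ultimately show ?thesis by linarith
      qed
      then show "\<exists>c. \<forall>\<^sub>F n in sequentially. ?S n (T x) \<le> ?S n x + e * real n + c"
        by (intro exI always_eventually allI)
    qed
    then show ?thesis using L_ereal[OF x] L_ereal[OF Tsp[OF x, of 1]] by simp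
  qed
  have L_Tn: "L ((T ^^ n) x) \<le> L x" if "x \<in> space M" for n x
    by (induction n) (use L_T Tsp[OF that] order_trans in \<open>fastforce+\<close>)
  show "(\<integral>x. L x \<partial>M) \<le> (\<integral>x. g x \<partial>M)"
  proof (rule field_le_epsilon)
    fix e :: real assume e: "0 < e"
    have "0 \<le> (\<integral>x. g x - L x + e \<partial>M)"
    proof (rule maximal_ergodic[OF T])
      show "integrable M (\<lambda>x. g x - L x + e)" using g_int L_int by simp
      fix x assume x: "x \<in> space M"
      \<comment> \<open>The index 0 is excluded because there the average is 0 by the convention for
        division by 0 and carries no information.\<close>
      have "\<exists>n\<ge>1. L x - e < 1 / real n * ?S n x"
      proof (rule ccontr)
        assume "\<not> ?thesis"
        then have "limsup (\<lambda>n. ereal (1 / real n * ?S n x)) \<le> ereal (L x - e)"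
          by (intro Limsup_bounded) (auto simp: eventually_sequentially not_less)
        then show False using L_ereal[OF x] e by simp
      qed
      then obtain n where n: "1 \<le> n" "L x - e < 1 / real n * ?S n x" by blast
      then have "real n * (L x - e) < ?S n x" by (simp add: field_simps)
      moreover have "(\<Sum>i<n. L ((T ^^ i) x)) \<le> real n * L x"
        using sum_bounded_above[of "{..<n}" "\<lambda>i. L ((T ^^ i) x)" "L x"] L_Tn[OF x] by simp
      moreover have "(\<Sum>i<n. g ((T ^^ i) x) - L ((T ^^ i) x) + e) =
          ?S n x - (\<Sum>i<n. L ((T ^^ i) x)) + real n * e"
        by (simp add: sum.distrib sum_subtractf)
      ultimately have "0 < (\<Sum>i<n. g ((T ^^ i) x) - L ((T ^^ i) x) + e)"
        by (simp add: algebra_simps)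
      then show "\<exists>n. 0 < (\<Sum>i<n. g ((T ^^ i) x) - L ((T ^^ i) x) + e)" by blast
    qed
    then show "(\<integral>x. L x \<partial>M) \<le> (\<integral>x. g x \<partial>M) + e"
      using g_int L_int by (simp add: prob_space)
  qed
qed

text \<open>A reverse Fatou lemma. The suprema \<open>v m\<close> over the tails dominate
  \<open>u m\<close> and decrease to the upper limit; the uniform bound \<open>K\<close> allows
  dominated convergence.\<close>

lemma (in prob_space) le_integral_limsup:
  fixes u :: "nat \<Rightarrow> 'a \<Rightarrow> real"
  assumes u: "\<And>n. u n \<in> borel_measurable M" "\<And>n x. x \<in> space M \<Longrightarrow> \<bar>u n x\<bar> \<le> K"
    and c: "\<And>n. 1 \<le> n \<Longrightarrow> c \<le> (\<integral>x. u n x \<partial>M)"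
  shows "c \<le> (\<integral>x. real_of_ereal (limsup (\<lambda>n. ereal (u n x))) \<partial>M)"
proof -
  define v where "v m x = (SUP n\<in>{m..}. ereal (u n x))" for m x
  define w where "w m x = real_of_ereal (v m x)" for m x
  have v_fin: "\<bar>v m x\<bar> \<noteq> \<infinity>" and w_bd: "\<bar>w m x\<bar> \<le> K" and u_w: "u m x \<le> w m x"
    if "x \<in> space M" for m x
  proof -
    have "ereal (u m x) \<le> v m x" unfolding v_def by (rule SUP_upper) simp
    moreover have "v m x \<le> ereal K"
      unfolding v_def using u(2)[OF that] by (intro SUP_least) (simp add: abs_le_iff)
    moreover have "- K \<le> u m x" using u(2)[OF that, of m] by linarith
    ultimately show "\<bar>v m x\<bar> \<noteq> \<infinity>" "\<bar>w m x\<bar> \<le> K" "u m x \<le> w m x"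
      unfolding w_def by (cases "v m x"; auto)+
  qed
  have w_meas: "w m \<in> borel_measurable M" for m
    unfolding w_def v_def using u(1) by measurable
  have "(\<lambda>m. \<integral>x. w m x \<partial>M) \<longlonglongrightarrow> (\<integral>x. real_of_ereal (limsup (\<lambda>n. ereal (u n x))) \<partial>M)"
  proof (rule integral_dominated_convergence[where w = "\<lambda>_. K"])
    show "AE x in M. (\<lambda>m. w m x) \<longlonglongrightarrow> real_of_ereal (limsup (\<lambda>n. ereal (u n x)))"
    proof (rule AE_I2)
      fix x assume x: "x \<in> space M"
      have "decseq (\<lambda>m. v m x)"
        unfolding v_def by (intro decseq_SucI SUP_subset_mono) auto
      then have "(\<lambda>m. v m x) \<longlonglongrightarrow> limsup (\<lambda>n. ereal (u n x))"
        unfolding limsup_INF_SUP v_def by (rule LIMSEQ_INF)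
      moreover have "limsup (\<lambda>n. ereal (u n x)) = ereal (real_of_ereal (limsup (\<lambda>n. ereal (u n x))))"
        using limsup_bounded_real(1)[of "\<lambda>n. u n x" K] u(2)[OF x] by (simp add: ereal_real)
      ultimately show "(\<lambda>m. w m x) \<longlonglongrightarrow> real_of_ereal (limsup (\<lambda>n. ereal (u n x)))"
        unfolding w_def by (metis lim_real_of_ereal)
    qed
    show "(\<lambda>x. real_of_ereal (limsup (\<lambda>n. ereal (u n x)))) \<in> borel_measurable M"
      using u(1) by measurable
  qed (use w_meas w_bd in auto)
  moreover have c_le: "c \<le> (\<integral>x. w m x \<partial>M)" if "1 \<le> m" for m
  proof -
    have "c \<le> (\<integral>x. u m x \<partial>M)" using c that .
    also have "\<dots> \<le> (\<integral>x. w m x \<partial>M)"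
      using u u_w w_bd w_meas by (intro integral_mono integrable_const_bound[of _ K]) auto
    finally show ?thesis .
  qed
  ultimately show ?thesis by (intro LIMSEQ_le_const[where a = c]) (auto intro: exI[of _ 1])
qed

section \<open>Sequences, blocks and subshifts\<close>

lemma length_block [simp]: "length (block x i n) = n"
  by (simp add: block_def)

lemma block_eq_iff: "block x i n = block z j n \<longleftrightarrow> (\<forall>k<n. x (i + int k) = z (j + int k))"
  unfolding list_eq_iff_nth_eq by (simp add: block_def)

lemma block_append: "block x i (n + m) = block x i n @ block x (i + int n) m"
  by (rule nth_equalityI) (auto simp: block_def nth_append)

lemma block_shift_pow: "block (shift_pow j x) i n = block x (i + j) n"
  by (simp add: block_def shift_pow_def add_ac)

lemma set_block: "range x \<subseteq> S \<Longrightarrow> set (block x i n) \<subseteq> S"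
  by (auto simp: block_def)

lemma shift_pow_add: "shift_pow i (shift_pow j x) = shift_pow (i + j) x"
  by (simp add: shift_pow_def add_ac)

lemma shift_pow_funpow: "(shift_pow (int n) ^^ l) x = shift_pow (int (l * n)) x"
  by (induction l) (auto simp add: shift_pow_def algebra_simps)

lemma open_if_window:
  fixes U :: "(int \<Rightarrow> 'a::discrete_topology) set"
  assumes "\<And>x z. x \<in> U \<Longrightarrow> (\<And>i. i \<in> {- int q..int q} \<Longrightarrow> z i = x i) \<Longrightarrow> z \<in> U"
  shows "open U"
  unfolding open_iff_seq_dist
proof
  fix x assume x: "x \<in> U"
  have "z \<in> U" if "seq_dist z x < (1/2) ^ q" for z
    using that unfolding seq_dist_less_iff by (intro assms[OF x]) blast
  then show "\<exists>e>0. \<forall>z. seq_dist z x < e \<longrightarrow> z \<in> U"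
    by (intro exI[of _ "(1/2) ^ q"]) simp
qed

lemma borel_measurable_if_window:
  fixes h :: "(int \<Rightarrow> 'a::discrete_topology) \<Rightarrow> real"
  assumes "\<And>x z. (\<And>i. i \<in> {- int q..int q} \<Longrightarrow> z i = x i) \<Longrightarrow> h z = h x"
  shows "h \<in> borel_measurable borel"
proof (rule borel_measurableI)
  fix S :: "real set"
  have "open (h -` S)"
  proof (rule open_if_window[of _ q])
    fix x z :: "int \<Rightarrow> 'a"
    assume "x \<in> h -` S" and "\<And>i. i \<in> {- int q..int q} \<Longrightarrow> z i = x i"
    moreover from this(2) have "h z = h x" by (rule assms)
    ultimately show "z \<in> h -` S" by simp
  qed
  then show "h -` S \<inter> space borel \<in> sets borel" by simp
qed

text \<open>Tychonoff: the set is a product of copies of the finite, hence compact, set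
  \<open>A\<close>.\<close>

lemma compact_sequences:
  fixes A :: "'a::discrete_topology set"
  assumes "finite A"
  shows "compact {x :: int \<Rightarrow> 'a. range x \<subseteq> A}"
proof -
  have "compactin (product_topology (\<lambda>_::int. euclidean) UNIV) (Pi\<^sub>E UNIV (\<lambda>_. A))"
    using assms by (simp add: compactin_PiE finite_imp_compact)
  moreover have "Pi\<^sub>E UNIV (\<lambda>_. A) = {x :: int \<Rightarrow> 'a. range x \<subseteq> A}" by auto
  ultimately show ?thesis by (simp add: euclidean_product_topology)
qed

lemma subshift_compact:
  assumes "subshift A X" shows "compact X"
proof -
  have "X \<inter> {x. range x \<subseteq> A} = X" "closed X" "finite A"
    using assms by (auto simp: subshift_def)
  then show ?thesis
    using closed_Int_compact[OF _ compact_sequences, of X A] by simp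
qed

lemma subshift_shift_pow:
  assumes "subshift A X" and x: "x \<in> X" shows "shift_pow m x \<in> X"
proof -
  have eq: "shift ` X = X" using assms by (simp add: subshift_def)
  have pos: "shift_pow (int n) x \<in> X" if "x \<in> X" for n x
    unfolding shift_pow_of_nat by (induction n) (use that eq in auto)
  have neg: "shift_pow (- int n) x \<in> X" for n
    using x
  proof (induction n arbitrary: x)
    case (Suc n)
    obtain z where "z \<in> X" "x = shift z" using Suc.prems eq by blast
    then show ?case using Suc.IH[of z] by (simp add: shift_pow_add)
  qed (simp add: shift_pow_def)
  show ?thesis using pos[OF x, of "nat m"] neg[of "nat (- m)"] by (cases "0 \<le> m") auto
qed

text \<open>A point is excluded by one bad symbol or one forbidden block, that is, by finitely many
  coordinates, so the complement is open. Occurrence of a block is insensitive to translation, which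
  gives invariance.\<close>

lemma shift_of_finite_type_subshift:
  assumes "shift_of_finite_type A X" shows "subshift A X"
proof -
  obtain F where A: "finite A" and X: "X = {x. range x \<subseteq> A \<and> (\<forall>w\<in>F. \<not> occurs w x)}"
    using assms by (auto simp: shift_of_finite_type_def)
  have occ: "occurs w (shift_pow m x) \<longleftrightarrow> occurs w x" for w m and x :: "int \<Rightarrow> 'a"
    unfolding occurs_def block_shift_pow
  proof
    assume "\<exists>i. block x i (length w) = w"
    then obtain i where "block x i (length w) = w" ..
    then have "block x (i - m + m) (length w) = w" by simp
    then show "\<exists>i. block x (i + m) (length w) = w" ..
  qed blast
  have "open (- X)"
    unfolding open_subopen[of "- X"]
  proof
    fix x assume "x \<in> - X"
    then consider k where "x k \<notin> A" | w i where "w \<in> F" "block x i (length w) = w"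
      by (auto simp: X occurs_def)
    then show "\<exists>T. open T \<and> x \<in> T \<and> T \<subseteq> - X"
    proof cases
      case 1
      have "open {z. z k \<notin> A}"
      proof (rule open_if_window[of _ "nat \<bar>k\<bar>"])
        fix y z :: "int \<Rightarrow> 'a"
        assume "y \<in> {z. z k \<notin> A}"
          and "\<And>i. i \<in> {- int (nat \<bar>k\<bar>)..int (nat \<bar>k\<bar>)} \<Longrightarrow> z i = y i"
        moreover have "- \<bar>k\<bar> \<le> k" by linarith
        ultimately show "z \<in> {z. z k \<notin> A}" by auto
      qed
      then show ?thesis using 1 by (intro exI[of _ "{z. z k \<notin> A}"]) (auto simp: X)
    next
      case 2
      have "open {z. block z i (length w) = w}"
      proof (rule open_if_window[of _ "nat \<bar>i\<bar> + length w"], rule CollectI)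
        fix y z :: "int \<Rightarrow> 'a"
        assume y: "y \<in> {z. block z i (length w) = w}"
          and eq: "\<And>j. j \<in> {- int (nat \<bar>i\<bar> + length w)..int (nat \<bar>i\<bar> + length w)} \<Longrightarrow> z j = y j"
        have "block z i (length w) = block y i (length w)"
          unfolding block_eq_iff by (auto intro!: eq)
        then show "block z i (length w) = w" using y by simp
      qed
      then show ?thesis using 2
        by (intro exI[of _ "{z. block z i (length w) = w}"]) (auto simp: X occurs_def)
    qed
  qed
  moreover have "shift ` X = X"
  proof
    show "shift ` X \<subseteq> X" by (auto simp: X occ) (auto simp: shift_pow_def)
    show "X \<subseteq> shift ` X"
    proof
      fix x assume "x \<in> X"
      then have "shift_pow (- 1) x \<in> X" by (auto simp: X occ) (auto simp: shift_pow_def)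
      then show "x \<in> shift ` X" using imageI[of _ X shift] shift_pow_uminus(2)[of 1 x] by fastforce
    qed
  qed
  ultimately show ?thesis using A by (auto simp: subshift_def closed_def X)
qed

lemma prod_lessThan_add:
  fixes g :: "nat \<Rightarrow> real"
  shows "(\<Prod>i<n + m. g i) = (\<Prod>i<n. g i) * (\<Prod>j<m. g (n + j))"
  by (induction m) (simp_all add: mult.assoc)

section \<open>Weighted block sums\<close>

text \<open>The factor enters only through the symbol map \<open>p\<close>; its points are collected
  in \<open>factor_space\<close> below. Nonnegativity of \<open>K\<close> is a separate assumption
  because \<open>f_bound\<close> is vacuous for empty \<open>X\<close>.\<close>

locale subshift_potential =
  fixes A :: "'a::discrete_topology set" and X :: "(int \<Rightarrow> 'a) set"
    and p :: "'a \<Rightarrow> 'b::discrete_topology" and f :: "(int \<Rightarrow> 'a) \<Rightarrow> real" and K :: real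
  assumes subshift: "subshift A X" and cont: "continuous_on X f"
    and f_bound: "\<And>x. x \<in> X \<Longrightarrow> \<bar>f x\<bar> \<le> K" and K_nonneg: "0 \<le> K"
begin

section \<open>Variation of the potential and comparison of the two weights\<close>

lemma finite_alphabet: "finite A" and range_alphabet: "x \<in> X \<Longrightarrow> range x \<subseteq> A"
  and shift_pow_in: "x \<in> X \<Longrightarrow> shift_pow m x \<in> X"
  using subshift subshift_shift_pow by (auto simp: subshift_def)

text \<open>Uniform continuity on the compact \<open>X\<close>, expressed by windows: finitely many
  cylinder neighbourhoods on which \<open>f\<close> stays within \<open>e / 2\<close> of its value
  at the centre cover \<open>X\<close>, and their largest window serves for all points.\<close>

lemma uniform_variation:
  assumes "0 < e"
  obtains m where "\<And>x z. x \<in> X \<Longrightarrow> z \<in> X \<Longrightarrow> (\<And>i. i \<in> {- int m..int m} \<Longrightarrow> z i = x i)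
    \<Longrightarrow> f z \<le> f x + e"
proof -
  let ?U = "\<lambda>(x :: int \<Rightarrow> 'a) q. {z. \<forall>i\<in>{- int q..int q}. z i = x i}"
  have "\<exists>q. \<forall>z\<in>X. z \<in> ?U x q \<longrightarrow> \<bar>f z - f x\<bar> < e / 2" if x: "x \<in> X" for x
  proof -
    let ?B = "{t. \<bar>t - f x\<bar> < e / 2}"
    have B: "open ?B"
      using open_ball[of "f x" "e / 2"] by (simp add: ball_def dist_real_def abs_minus_commute)
    have fx: "f x \<in> ?B" using assms by simp
    from cont[unfolded continuous_on_topological, rule_format, OF x B fx]
    obtain V where V: "open V" "x \<in> V" "\<forall>z\<in>X. z \<in> V \<longrightarrow> f z \<in> ?B" by blast
    from V(1)[unfolded open_iff_seq_dist, rule_format, OF V(2)]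
    obtain d where d: "0 < d" "\<forall>z. seq_dist z x < d \<longrightarrow> z \<in> V" by blast
    then obtain q where q: "(1/2) ^ q < d" using real_arch_pow_inv[of d "1/2"] by auto
    have "z \<in> V" if "z \<in> ?U x q" for z
    proof -
      have "seq_dist z x < (1/2) ^ q" using that unfolding seq_dist_less_iff by simp
      then show ?thesis using d(2) q by (meson order_less_trans)
    qed
    then have "\<forall>z\<in>X. z \<in> ?U x q \<longrightarrow> \<bar>f z - f x\<bar> < e / 2" using V(3) by fast
    then show ?thesis ..
  qed
  then have "\<forall>x\<in>X. \<exists>q. \<forall>z\<in>X. z \<in> ?U x q \<longrightarrow> \<bar>f z - f x\<bar> < e / 2" by (rule ballI)
  from bchoice[OF this] obtain q
    where q: "\<forall>x\<in>X. \<forall>z\<in>X. z \<in> ?U x (q x) \<longrightarrow> \<bar>f z - f x\<bar> < e / 2" ..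
  have open_U: "open (?U x k)" for x :: "int \<Rightarrow> 'a" and k
  proof (rule open_if_window[of _ k], intro CollectI ballI)
    fix y z i
    assume "y \<in> ?U x k" and eq: "\<And>i. i \<in> {- int k..int k} \<Longrightarrow> z i = y i"
      and i: "i \<in> {- int k..int k}"
    then have "y i = x i" by blast
    then show "z i = x i" using eq[OF i] by simp
  qed
  have "X \<subseteq> (\<Union>x\<in>X. ?U x (q x))" by blast
  from compactE_image[OF subshift_compact[OF subshift] open_U this] obtain D
    where D: "D \<subseteq> X" "finite D" "X \<subseteq> (\<Union>x\<in>D. ?U x (q x))" by blast
  obtain m where m: "\<And>x. x \<in> D \<Longrightarrow> q x \<le> m"
    using D(2) finite_nat_set_iff_bounded_le[of "q ` D"] by auto
  show ?thesis
  proof (rule that[of m])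
    fix x z assume xz: "x \<in> X" "z \<in> X" and eq: "\<And>i. i \<in> {- int m..int m} \<Longrightarrow> z i = x i"
    obtain w where w: "w \<in> D" "x \<in> ?U w (q w)" using D(3) xz by blast
    have "z i = w i" if "i \<in> {- int (q w)..int (q w)}" for i
    proof -
      have "i \<in> {- int m..int m}" using that m[OF w(1)] by auto
      then have "z i = x i" by (rule eq)
      moreover have "x i = w i" using w(2) that by blast
      ultimately show ?thesis by simp
    qed
    then have "z \<in> ?U w (q w)" by blast
    moreover have "w \<in> X" using w(1) D(1) by blast
    ultimately have "\<bar>f z - f w\<bar> < e / 2" "\<bar>f x - f w\<bar> < e / 2"
      using q xz w(2) by simp_all
    then show "f z \<le> f x + e" by linarith
  qed
qed

text \<open>The substitution \<open>z = shift_pow (- int i) x\<close> puts the block at the origin,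
  so that all positions \<open>i\<close> refer to the same cylinder.\<close>

lemma F_sup_eq: "F_sup X f i B = (SUP z\<in>cylinder X B. exp (f (shift_pow (int i) z)))"
  and F_inf_eq: "F_inf X f i B = (INF z\<in>cylinder X B. exp (f (shift_pow (int i) z)))"
proof -
  have "{exp (f x) |x. x \<in> X \<and> shift_pow (- int i) x \<in> cylinder X B} =
      (\<lambda>z. exp (f (shift_pow (int i) z))) ` cylinder X B"
  proof (safe)
    fix x assume "x \<in> X" "shift_pow (- int i) x \<in> cylinder X B"
    then show "exp (f x) \<in> (\<lambda>z. exp (f (shift_pow (int i) z))) ` cylinder X B"
      by (metis (no_types, lifting) image_eqI shift_pow_uminus(2))
  next
    fix z assume "z \<in> cylinder X B"
    then show "\<exists>x. exp (f (shift_pow (int i) z)) = exp (f x) \<and> x \<in> X \<and>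
        shift_pow (- int i) x \<in> cylinder X B"
      using shift_pow_in[of z "int i"]
      by (intro exI[of _ "shift_pow (int i) z"]) (auto simp: shift_pow_uminus cylinder_def)
  qed
  then show "F_sup X f i B = (SUP z\<in>cylinder X B. exp (f (shift_pow (int i) z)))"
    "F_inf X f i B = (INF z\<in>cylinder X B. exp (f (shift_pow (int i) z)))"
    by (simp_all add: F_sup_def F_inf_def)
qed

lemma exp_bounds:
  assumes "x \<in> X" shows "exp (- K) \<le> exp (f x)" "exp (f x) \<le> exp K"
  using f_bound[OF assms] by (auto simp: abs_le_iff)

lemma bdd_exp:
  "bdd_above ((\<lambda>z. exp (f (shift_pow i z))) ` cylinder X B)"
  "bdd_below ((\<lambda>z. exp (f (shift_pow i z))) ` cylinder X B)"
  using exp_bounds shift_pow_in unfolding bdd_above_def bdd_below_def cylinder_def by blast+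

lemma F_bounds:
  assumes "z \<in> cylinder X B"
  shows "exp (f (shift_pow (int i) z)) \<le> F_sup X f i B"
    and "F_inf X f i B \<le> exp (f (shift_pow (int i) z))"
    and "exp (- K) \<le> F_inf X f i B" and "F_sup X f i B \<le> exp K"
    and "exp (- K) \<le> F_sup X f i B"
proof -
  show 1: "exp (f (shift_pow (int i) z)) \<le> F_sup X f i B"
    unfolding F_sup_eq using assms bdd_exp by (intro cSUP_upper) auto
  show "F_inf X f i B \<le> exp (f (shift_pow (int i) z))"
    unfolding F_inf_eq using assms bdd_exp by (intro cINF_lower) auto
  show "exp (- K) \<le> F_inf X f i B"
    unfolding F_inf_eq using assms exp_bounds shift_pow_in
    by (intro cINF_greatest) (auto simp: cylinder_def simp del: exp_le_cancel_iff)
  show "F_sup X f i B \<le> exp K"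
    unfolding F_sup_eq using assms exp_bounds shift_pow_in
    by (intro cSUP_least) (auto simp: cylinder_def simp del: exp_le_cancel_iff)
  have "z \<in> X" using assms by (simp add: cylinder_def)
  then show "exp (- K) \<le> F_sup X f i B"
    using 1 exp_bounds(1)[OF shift_pow_in[of z "int i"]] by linarith
qed

lemma s_bounds:
  assumes z: "z \<in> cylinder X B"
  shows "exp (\<Sum>i<length B. f (shift_pow (int i) z)) \<le> s_sup X f B"
    and "s_inf X f B \<le> exp (\<Sum>i<length B. f (shift_pow (int i) z))"
    and "0 < s_inf X f B" and "0 < s_sup X f B"
    and "exp (- K) ^ length B \<le> s_sup X f B" and "s_sup X f B \<le> exp K ^ length B"
proof -
  have pos: "0 < F_inf X f i B" "0 < F_sup X f i B" for i
    using F_bounds[OF z, of i] exp_gt_zero[of "- K"] by linarith+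
  show "exp (\<Sum>i<length B. f (shift_pow (int i) z)) \<le> s_sup X f B"
    unfolding s_sup_def exp_sum[OF finite_lessThan] using F_bounds(1)[OF z] by (intro prod_mono) auto
  show "s_inf X f B \<le> exp (\<Sum>i<length B. f (shift_pow (int i) z))"
    unfolding s_inf_def exp_sum[OF finite_lessThan]
    using F_bounds(2)[OF z] pos by (intro prod_mono) (auto intro: less_imp_le)
  show "0 < s_inf X f B" "0 < s_sup X f B"
    unfolding s_inf_def s_sup_def using pos by (auto intro: prod_pos)
  have "(\<Prod>i<length B. exp (- K)) \<le> s_sup X f B"
    unfolding s_sup_def using F_bounds(5)[OF z] by (intro prod_mono) auto
  then show "exp (- K) ^ length B \<le> s_sup X f B" by simp
  have "s_sup X f B \<le> (\<Prod>i<length B. exp K)"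
    unfolding s_sup_def using F_bounds(4)[OF z] pos(2) by (intro prod_mono) (auto intro: less_imp_le)
  then show "s_sup X f B \<le> exp K ^ length B" by simp
qed

text \<open>Only the coordinates within distance \<open>m\<close> of an end of the block see a variation of \<open>f\<close>
  that is not small.\<close>

lemma s_sup_le_s_inf:
  assumes "0 < e"
  obtains c where "\<And>B. cylinder X B \<noteq> {} \<Longrightarrow> s_sup X f B \<le> exp (e * real (length B) + c) * s_inf X f B"
proof -
  obtain m where m: "\<And>x z. x \<in> X \<Longrightarrow> z \<in> X \<Longrightarrow>
      (\<And>i. i \<in> {- int m..int m} \<Longrightarrow> z i = x i) \<Longrightarrow> f z \<le> f x + e"
    using uniform_variation[OF assms] by blast
  show ?thesis
  \<comment> \<open>At most \<open>m\<close> positions at each end are exceptional, and each costs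
    at most the full oscillation \<open>2 * K\<close> of \<open>f\<close>.\<close>
  proof (rule that[of "2 * real m * (2 * K)"])
    fix B assume "cylinder X B \<noteq> {}"
    then obtain z0 where z0: "z0 \<in> cylinder X B" by blast
    let ?n = "length B"
    \<comment> \<open>Extra allowance at position \<open>i\<close>: it vanishes exactly when the
      window of radius \<open>m\<close> around \<open>i\<close> lies inside the block.\<close>
    define c where "c i = (if i < m \<or> ?n \<le> i + m then 2 * K else 0)" for i
    have c_nonneg: "0 \<le> c i" for i using K_nonneg by (simp add: c_def)
    have F: "F_sup X f i B \<le> exp (e + c i) * F_inf X f i B" if i: "i < ?n" for i
    proof -
      have fz: "f (shift_pow (int i) z) \<le> f (shift_pow (int i) z') + (e + c i)"
        if z: "z \<in> cylinder X B" "z' \<in> cylinder X B" for z z'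
      proof (cases "i < m \<or> ?n \<le> i + m")
        case True
        have "z \<in> X" "z' \<in> X" using z by (auto simp: cylinder_def)
        then show ?thesis
          using f_bound[OF shift_pow_in[of z "int i"]] f_bound[OF shift_pow_in[of z' "int i"]]
            True assms by (simp add: c_def abs_le_iff)
      next
        case False
        have zz: "z j = z' j" if "0 \<le> j" "j < int ?n" for j
        proof -
          have "block z 0 ?n = block z' 0 ?n" using z by (simp add: cylinder_def)
          then show ?thesis unfolding block_eq_iff using that by (metis add_0 nonneg_int_cases of_nat_less_iff)
        qed
        have "f (shift_pow (int i) z) \<le> f (shift_pow (int i) z') + e"
        proof (rule m)
          fix j assume "j \<in> {- int m..int m}"
          then show "shift_pow (int i) z j = shift_pow (int i) z' j"
            using False unfolding shift_pow_def by (intro zz) auto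
        qed (use z in \<open>auto simp: cylinder_def intro: shift_pow_in\<close>)
        then show ?thesis using c_nonneg[of i] by linarith
      qed
      have "exp (- (e + c i)) * F_sup X f i B \<le> F_inf X f i B"
        unfolding F_inf_eq
      proof (rule cINF_greatest)
        fix z' assume z': "z' \<in> cylinder X B"
        have "F_sup X f i B \<le> exp (e + c i) * exp (f (shift_pow (int i) z'))"
          unfolding F_sup_eq exp_add[symmetric]
        proof (rule cSUP_least)
          fix z assume "z \<in> cylinder X B"
          from fz[OF this z'] show "exp (f (shift_pow (int i) z)) \<le> exp (e + c i + f (shift_pow (int i) z'))"
            by simp
        qed (use z' in auto)
        then show "exp (- (e + c i)) * F_sup X f i B \<le> exp (f (shift_pow (int i) z'))"
          by (simp only: exp_minus) (simp add: field_simps)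
      qed (use z0 in auto)
      then show ?thesis by (simp only: exp_minus) (simp add: field_simps)
    qed
    have "(\<Sum>i<?n. c i) = (\<Sum>i\<in>{i. i < ?n \<and> (i < m \<or> ?n \<le> i + m)}. 2 * K)"
      unfolding c_def by (subst sum.inter_filter[symmetric]) (auto simp: conj_commute intro!: sum.cong)
    also have "\<dots> = real (card {i. i < ?n \<and> (i < m \<or> ?n \<le> i + m)}) * (2 * K)" by simp
    also have "\<dots> \<le> real (2 * m) * (2 * K)"
    proof (rule mult_right_mono)
      have "card {i. i < ?n \<and> (i < m \<or> ?n \<le> i + m)} \<le> card ({..<m} \<union> {?n - m..<?n})"
        by (rule card_mono) auto
      also have "\<dots> \<le> card {..<m} + card {?n - m..<?n}" by (rule card_Un_le)
      also have "\<dots> \<le> 2 * m" by simp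
      finally show "real (card {i. i < ?n \<and> (i < m \<or> ?n \<le> i + m)}) \<le> real (2 * m)" by simp
    qed (use K_nonneg in simp)
    finally have c_sum: "(\<Sum>i<?n. c i) \<le> 2 * real m * (2 * K)" by simp
    have "s_sup X f B \<le> (\<Prod>i<?n. exp (e + c i) * F_inf X f i B)"
      unfolding s_sup_def
    proof (rule prod_mono)
      fix i assume "i \<in> {..<?n}"
      then show "0 \<le> F_sup X f i B \<and> F_sup X f i B \<le> exp (e + c i) * F_inf X f i B"
        using F[of i] order_trans[OF exp_ge_zero F_bounds(5)[OF z0]] by simp
    qed
    also have "\<dots> = exp (\<Sum>i<?n. e + c i) * s_inf X f B"
      by (simp add: prod.distrib exp_sum s_inf_def)
    also have "\<dots> \<le> exp (e * real ?n + 2 * real m * (2 * K)) * s_inf X f B"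
    proof (rule mult_right_mono)
      show "exp (\<Sum>i<?n. e + c i) \<le> exp (e * real ?n + 2 * real m * (2 * K))"
        using c_sum by (simp add: sum.distrib mult.commute)
    qed (use s_bounds(3)[OF z0] in simp)
    finally show "s_sup X f B \<le> exp (e * real ?n + 2 * real m * (2 * K)) * s_inf X f B" .
  qed
qed

text \<open>A longer block cuts out a smaller cylinder, so each supremum is at most the
  corresponding one for the part; for the second part the cylinder is first translated by
  \<open>n\<close>. Infima would go the other way, which is why \<open>Z\<close> below is built from
  \<open>s_sup\<close>.\<close>

lemma s_sup_append:
  assumes x: "x \<in> X"
  shows "s_sup X f (block x 0 (n + m)) \<le> s_sup X f (block x 0 n) * s_sup X f (block x (int n) m)"
proof -
  let ?B = "block x 0 (n + m)" and ?B1 = "block x 0 n" and ?B2 = "block x (int n) m"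
  have cyl: "x \<in> cylinder X ?B" using x by (simp add: cylinder_def)
  have sub1: "cylinder X ?B \<subseteq> cylinder X ?B1"
    by (auto simp: cylinder_def block_append)
  have sub2: "shift_pow (int n) z \<in> cylinder X ?B2" if "z \<in> cylinder X ?B" for z
    using that shift_pow_in by (auto simp: cylinder_def block_append block_shift_pow)
  have le1: "F_sup X f i ?B \<le> F_sup X f i ?B1" for i
    unfolding F_sup_eq using cyl sub1 bdd_exp by (intro cSUP_subset_mono) auto
  have le2: "F_sup X f (n + j) ?B \<le> F_sup X f j ?B2" for j
    unfolding F_sup_eq[of "n + j"]
  proof (rule cSUP_least)
    fix z assume "z \<in> cylinder X ?B"
    from F_bounds(1)[OF sub2[OF this], of j]
    show "exp (f (shift_pow (int (n + j)) z)) \<le> F_sup X f j ?B2"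
      by (simp add: shift_pow_add add.commute)
  qed (use cyl in auto)
  have nonneg: "0 \<le> F_sup X f i ?B" for i
    using F_bounds(5)[OF cyl, of i] exp_gt_zero[of "- K"] by linarith
  have "s_sup X f ?B = (\<Prod>i<n. F_sup X f i ?B) * (\<Prod>j<m. F_sup X f (n + j) ?B)"
    unfolding s_sup_def length_block by (rule prod_lessThan_add)
  also have "\<dots> \<le> (\<Prod>i<n. F_sup X f i ?B1) * (\<Prod>j<m. F_sup X f j ?B2)"
    using le1 le2 nonneg order_trans[OF nonneg le1]
    by (intro mult_mono prod_mono prod_nonneg) auto
  finally show ?thesis by (simp add: s_sup_def)
qed

section \<open>Sums over lifts and their bounds\<close>

definition lifts :: "int set \<Rightarrow> nat \<Rightarrow> (int \<Rightarrow> 'b) \<Rightarrow> 'a list set" where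
  "lifts I n y = {block x 0 n | x. x \<in> X \<and> (\<forall>i\<in>I. p (x i) = y i)}"

text \<open>The block always sits on \<open>[0, n)\<close>, whereas \<open>I\<close> is where its
  extension must project to \<open>y\<close>. The logarithm of \<open>Z\<close> for \<open>I\<close>
  equal to \<open>{0..<int n}\<close>, \<open>{- int k..<int (n + k)}\<close> and
  \<open>UNIV\<close> is \<open>\<phi>\<^sub>n\<close>, \<open>\<phi>\<^sup>k\<^sub>n\<close> and
  \<open>\<psi>\<^sub>n\<close> respectively; the empty \<open>I\<close> imposes no
  constraint.\<close>

definition Z :: "int set \<Rightarrow> nat \<Rightarrow> (int \<Rightarrow> 'b) \<Rightarrow> real" where
  "Z I n y = (\<Sum>B\<in>lifts I n y. s_sup X f B)"

definition factor_space :: "(int \<Rightarrow> 'b) set" where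
  "factor_space = (\<lambda>x i. p (x i)) ` X"

text \<open>Exponential bound for \<open>Z\<close>: there are at most \<open>card A ^ n\<close>
  blocks, each of weight at most \<open>exp K ^ n\<close>.\<close>

definition rate :: real where
  "rate = K + ln (real (card A))"

lemma factor_space_shift_pow: "y \<in> factor_space \<Longrightarrow> shift_pow m y \<in> factor_space"
proof -
  assume "y \<in> factor_space"
  then obtain x where "x \<in> X" "y = (\<lambda>i. p (x i))" by (auto simp: factor_space_def)
  then show "shift_pow m y \<in> factor_space"
    unfolding factor_space_def by (intro image_eqI[of _ _ "shift_pow m x"]) 
      (auto simp: shift_pow_def shift_pow_in[unfolded shift_pow_def])
qed

lemma lifts_subset: "lifts I n y \<subseteq> {B. set B \<subseteq> A \<and> length B = n}"
  unfolding lifts_def using set_block range_alphabet by fastforce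

lemma finite_lifts: "finite (lifts I n y)"
  using lifts_subset finite_lists_length_eq[OF finite_alphabet] by (rule finite_subset)

lemma lifts_length: "B \<in> lifts I n y \<Longrightarrow> length B = n"
  using lifts_subset by blast

lemma lifts_mono: "J \<subseteq> I \<Longrightarrow> lifts I n y \<subseteq> lifts J n y"
  unfolding lifts_def by blast

lemma lifts_cylinder: "B \<in> lifts I n y \<Longrightarrow> \<exists>z. z \<in> cylinder X B"
  unfolding lifts_def cylinder_def by auto

lemma s_sup_lifts_pos: "B \<in> lifts I n y \<Longrightarrow> 0 < s_sup X f B"
  using lifts_cylinder s_bounds(4) by blast

lemma Z_mono: "J \<subseteq> I \<Longrightarrow> Z I n y \<le> Z J n y"
  unfolding Z_def
  by (intro sum_mono2 finite_lifts lifts_mono less_imp_le[OF s_sup_lifts_pos]) auto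

lemma Z_pos:
  assumes "y \<in> factor_space" shows "0 < Z I n y"
proof -
  obtain x where x: "x \<in> X" "y = (\<lambda>i. p (x i))" using assms by (auto simp: factor_space_def)
  then have "block x 0 n \<in> lifts I n y" unfolding lifts_def by auto
  then show ?thesis unfolding Z_def
    using s_sup_lifts_pos finite_lifts by (intro sum_pos2[of _ "block x 0 n"]) (auto intro: less_imp_le)
qed

lemma card_alphabet: "y \<in> factor_space \<Longrightarrow> 1 \<le> card A"
  using range_alphabet finite_alphabet by (auto simp: factor_space_def Suc_le_eq card_gt_0_iff)

text \<open>Counting gives the upper bound. A single lift gives the lower bound
  \<open>- (real n * K)\<close>, and \<open>K\<close> is at most \<open>rate\<close> because the
  alphabet is nonempty. Uniformity in \<open>I\<close> later supplies the dominating
  constants.\<close>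

lemma ln_Z_bounds:
  assumes y: "y \<in> factor_space"
  shows "ln (Z I n y) \<le> real n * rate" and "\<bar>ln (Z I n y)\<bar> \<le> real n * rate"
proof -
  have c: "1 \<le> real (card A)" using card_alphabet[OF y] by simp
  have Z: "0 < Z I n y" using Z_pos[OF y] .
  have "Z I n y \<le> (\<Sum>B\<in>lifts I n y. exp K ^ n)"
    unfolding Z_def
  proof (rule sum_mono)
    fix B assume B: "B \<in> lifts I n y"
    then obtain z where "z \<in> cylinder X B" using lifts_cylinder by blast
    from s_bounds(6)[OF this] show "s_sup X f B \<le> exp K ^ n" using lifts_length[OF B] by simp
  qed
  also have "\<dots> = real (card (lifts I n y)) * exp K ^ n" by simp
  also have "\<dots> \<le> real (card A ^ n) * exp K ^ n"
  proof (rule mult_right_mono)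
    have "card (lifts I n y) \<le> card A ^ n"
      using card_mono[OF finite_lists_length_eq[OF finite_alphabet] lifts_subset]
      by (simp add: card_lists_length_eq finite_alphabet)
    then show "real (card (lifts I n y)) \<le> real (card A ^ n)" by (rule of_nat_mono)
  qed simp
  finally have "ln (Z I n y) \<le> ln (real (card A ^ n) * exp K ^ n)"
    using Z by (intro ln_mono) auto
  also have "\<dots> = real n * rate"
    using c by (simp add: rate_def ln_mult ln_realpow algebra_simps)
  finally show upper: "ln (Z I n y) \<le> real n * rate" .
  obtain x where x: "x \<in> X" "y = (\<lambda>i. p (x i))" using y by (auto simp: factor_space_def)
  let ?B = "block x 0 n"
  have B: "?B \<in> lifts I n y" using x unfolding lifts_def by auto
  have "x \<in> cylinder X ?B" using x by (simp add: cylinder_def)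
  from s_bounds(5)[OF this] have "exp (- K) ^ n \<le> s_sup X f ?B" by simp
  also have "\<dots> \<le> Z I n y" unfolding Z_def
    using B finite_lifts s_sup_lifts_pos by (intro member_le_sum) (auto intro: less_imp_le)
  finally have "ln (exp (- K) ^ n) \<le> ln (Z I n y)" by (intro ln_mono) auto
  then have "- (real n * K) \<le> ln (Z I n y)" by (simp add: ln_realpow)
  moreover have "real n * K \<le> real n * rate"
    unfolding rate_def using c by (intro mult_left_mono) auto
  ultimately show "\<bar>ln (Z I n y)\<bar> \<le> real n * rate" using upper by linarith
qed

lemma rate_nonneg: "y \<in> factor_space \<Longrightarrow> 0 \<le> rate"
  using ln_Z_bounds(2)[of y "{}" 1] by simp

section \<open>Submultiplicativity and cutting of long blocks\<close>

text \<open>Cutting at \<open>n\<close> injects the lifts into a product of lifts, and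
  \<open>s_sup_append\<close> bounds the weights. The two windows on the right may be any whose
  constraints follow from \<open>I\<close>, the second after translation by
  \<open>n\<close>.\<close>

lemma Z_submult:
  assumes "J \<subseteq> I" "\<And>i. i \<in> J' \<Longrightarrow> i + int n \<in> I"
  shows "Z I (n + m) y \<le> Z J n y * Z J' m (shift_pow (int n) y)"
proof -
  let ?s = "s_sup X f" and ?split = "\<lambda>B :: 'a list. (take n B, drop n B)"
  have mem: "?split B \<in> lifts J n y \<times> lifts J' m (shift_pow (int n) y)"
    and le: "?s B \<le> ?s (take n B) * ?s (drop n B)" if B: "B \<in> lifts I (n + m) y" for B
  proof -
    obtain x where x: "B = block x 0 (n + m)" "x \<in> X" "\<forall>i\<in>I. p (x i) = y i"
      using B unfolding lifts_def by blast
    have td: "take n B = block x 0 n" "drop n B = block x (int n) m"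
      by (simp_all add: x(1) block_append)
    then show "?s B \<le> ?s (take n B) * ?s (drop n B)" using s_sup_append x by simp
    have "block x 0 n \<in> lifts J n y" using x assms(1) unfolding lifts_def by auto
    moreover have "block x (int n) m \<in> lifts J' m (shift_pow (int n) y)"
      unfolding lifts_def
    proof (intro CollectI exI conjI)
      show "block x (int n) m = block (shift_pow (int n) x) 0 m" by (simp add: block_shift_pow)
      show "shift_pow (int n) x \<in> X" using x shift_pow_in by blast
      show "\<forall>i\<in>J'. p (shift_pow (int n) x i) = shift_pow (int n) y i"
        using x(3) assms(2) by (simp add: shift_pow_def)
    qed
    ultimately show "?split B \<in> lifts J n y \<times> lifts J' m (shift_pow (int n) y)" using td by simp
  qed
  have inj: "inj_on ?split (lifts I (n + m) y)"
    by (rule inj_onI) (metis append_take_drop_id prod.inject)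
  have "Z I (n + m) y \<le> (\<Sum>B\<in>lifts I (n + m) y. ?s (take n B) * ?s (drop n B))"
    unfolding Z_def by (rule sum_mono) (rule le)
  also have "\<dots> = (\<Sum>(C, D)\<in>?split ` lifts I (n + m) y. ?s C * ?s D)"
    by (simp add: sum.reindex[OF inj])
  also have "\<dots> \<le> (\<Sum>(C, D)\<in>lifts J n y \<times> lifts J' m (shift_pow (int n) y). ?s C * ?s D)"
  proof (rule sum_mono2)
    show "?split ` lifts I (n + m) y \<subseteq> lifts J n y \<times> lifts J' m (shift_pow (int n) y)"
      using mem by blast
  qed (use finite_lifts s_sup_lifts_pos in \<open>auto intro!: mult_nonneg_nonneg less_imp_le\<close>)
  also have "\<dots> = Z J n y * Z J' m (shift_pow (int n) y)"
    unfolding Z_def by (simp add: sum_product sum.cartesian_product)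
  finally show ?thesis .
qed

lemma ln_Z_subadd:
  assumes "y \<in> factor_space" "J \<subseteq> I" "\<And>i. i \<in> J' \<Longrightarrow> i + int n \<in> I"
  shows "ln (Z I (n + m) y) \<le> ln (Z J n y) + ln (Z J' m (shift_pow (int n) y))"
proof -
  have pos: "0 < Z J n y" "0 < Z J' m (shift_pow (int n) y)" "0 < Z I (n + m) y"
    using assms(1) factor_space_shift_pow Z_pos by auto
  have "ln (Z I (n + m) y) \<le> ln (Z J n y * Z J' m (shift_pow (int n) y))"
    using Z_submult[OF assms(2,3), where m = m] pos by (intro ln_mono) auto
  then show ?thesis using pos by (simp add: ln_mult)
qed

text \<open>The induction splits off the last block, whose collar of width \<open>k\<close> overlaps
  its predecessor. \<open>I\<close> varies because the window for the first \<open>q\<close> blocks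
  then ends earlier, at \<open>q * n + k\<close>.\<close>

lemma ln_Z_blocks:
  assumes y: "y \<in> factor_space" and I: "{- int k..<int (q * n + k)} \<subseteq> I"
  shows "ln (Z I (q * n) y) \<le>
    (\<Sum>l<q. ln (Z {- int k..<int (n + k)} n (shift_pow (int (l * n)) y)))"
  using I
proof (induction q arbitrary: I)
  case 0
  then show ?case using ln_Z_bounds(1)[OF y, of I 0] by simp
next
  case (Suc q)
  have "ln (Z I (q * n + n) y) \<le> ln (Z {- int k..<int (q * n + k)} (q * n) y)
      + ln (Z {- int k..<int (n + k)} n (shift_pow (int (q * n)) y))"
  proof (rule ln_Z_subadd[OF y])
    show "{- int k..<int (q * n + k)} \<subseteq> I" using Suc.prems by auto
    show "i + int (q * n) \<in> I" if "i \<in> {- int k..<int (n + k)}" for i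
    proof -
      have "i + int (q * n) \<in> {- int k..<int (Suc q * n + k)}"
        using that by (simp add: add_increasing2)
      then show ?thesis using Suc.prems by blast
    qed
  qed
  then show ?case using Suc.IH[of "{- int k..<int (q * n + k)}"] by (simp add: add.commute)
qed

text \<open>Constraints on \<open>[0, N)\<close> leave room for collars of width \<open>k\<close>
  only after trimming both ends. The \<open>k\<close> coordinates on the left and
  \<open>k + r\<close> on the right are estimated by \<open>rate\<close> without any constraint;
  block \<open>l\<close> starts at \<open>k + l * n\<close>.\<close>

lemma ln_Z_window:
  assumes y: "y \<in> factor_space"
  shows "ln (Z {0..<int (2 * k + q * n + r)} (2 * k + q * n + r) y) \<le>
    (\<Sum>l<q. ln (Z {- int k..<int (n + k)} n (shift_pow (int (l * n) + int k) y)))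
      + real (2 * k + r) * rate"
proof -
  let ?N = "2 * k + q * n + r" and ?J = "{- int k..<int (q * n + k)}"
  have N: "?N = k + (q * n + (k + r))" by simp
  have y': "shift_pow (int k) y \<in> factor_space" using y by (rule factor_space_shift_pow)
  have "ln (Z {0..<int ?N} ?N y) \<le> ln (Z {} k y)
      + ln (Z ?J (q * n + (k + r)) (shift_pow (int k) y))"
    unfolding N by (rule ln_Z_subadd[OF y]) auto
  also have "ln (Z {} k y) \<le> real k * rate" using ln_Z_bounds[OF y] by blast
  also have "ln (Z ?J (q * n + (k + r)) (shift_pow (int k) y)) \<le>
      ln (Z ?J (q * n) (shift_pow (int k) y)) +
      ln (Z {} (k + r) (shift_pow (int (q * n)) (shift_pow (int k) y)))"
    by (rule ln_Z_subadd[OF y']) auto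
  also have "ln (Z {} (k + r) (shift_pow (int (q * n)) (shift_pow (int k) y))) \<le> real (k + r) * rate"
    using ln_Z_bounds factor_space_shift_pow y' by blast
  also have "ln (Z ?J (q * n) (shift_pow (int k) y)) \<le>
      (\<Sum>l<q. ln (Z {- int k..<int (n + k)} n (shift_pow (int (l * n) + int k) y)))"
    using ln_Z_blocks[OF y', of k q n ?J] by (simp add: shift_pow_add)
  finally show ?thesis by (simp add: algebra_simps)
qed

section \<open>Compactness and measurability of the fibre sums\<close>

text \<open>Each \<open>k\<close> may require a different point over \<open>B\<close>, but the sets
  \<open>C k\<close> are closed and decreasing, so compactness of \<open>X\<close> gives a point
  that works for all of them.\<close>

lemma lifts_UNIV_iff: "B \<in> lifts UNIV n y \<longleftrightarrow> (\<forall>k. B \<in> lifts {- int k..<int (n + k)} n y)"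
proof
  assume "\<forall>k. B \<in> lifts {- int k..<int (n + k)} n y"
  then have ne: "\<exists>x\<in>X. block x 0 n = B \<and> (\<forall>i\<in>{- int k..<int (n + k)}. p (x i) = y i)" for k
    unfolding lifts_def by blast
  define C where "C k = {x :: int \<Rightarrow> 'a. block x 0 n = B \<and> (\<forall>i\<in>{- int k..<int (n + k)}. p (x i) = y i)}" for k
  have "X \<inter> (\<Inter>k\<in>UNIV. C k) \<noteq> {}"
  proof (rule compact_imp_fip_image[OF subshift_compact[OF subshift]])
    fix k
    show "closed (C k)" unfolding closed_def
    proof (rule open_if_window[of _ "n + k"], rule ComplI)
      fix x z assume x: "x \<in> - C k" and z: "z \<in> C k"
        and eq: "\<And>i. i \<in> {- int (n + k)..int (n + k)} \<Longrightarrow> z i = x i"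
      have "block x 0 n = block z 0 n" unfolding block_eq_iff
      proof (intro allI impI)
        fix j assume "j < n"
        then have "0 + int j \<in> {- int (n + k)..int (n + k)}" by auto
        from eq[OF this] show "x (0 + int j) = z (0 + int j)" by simp
      qed
      moreover have "p (x i) = y i" if i: "i \<in> {- int k..<int (n + k)}" for i
      proof -
        have "i \<in> {- int (n + k)..int (n + k)}" using i by auto
        then have "z i = x i" by (rule eq)
        moreover have "p (z i) = y i" using z i unfolding C_def by blast
        ultimately show ?thesis by simp
      qed
      ultimately have "x \<in> C k" using z unfolding C_def by auto
      then show False using x by blast
    qed
  next
    fix I' :: "nat set" assume "finite I'"
    then obtain m where m: "\<forall>k\<in>I'. k \<le> m" using finite_nat_set_iff_bounded_le by blast
    obtain x where x: "x \<in> X" "x \<in> C m" using ne[of m] unfolding C_def by blast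
    have "C m \<subseteq> C k" if "k \<in> I'" for k
    proof -
      have "{- int k..<int (n + k)} \<subseteq> {- int m..<int (n + m)}" using m that by auto
      then show ?thesis unfolding C_def by blast
    qed
    then show "X \<inter> (\<Inter>k\<in>I'. C k) \<noteq> {}" using x by blast
  qed
  then obtain x where x: "x \<in> X" "\<And>k. x \<in> C k" by blast
  have "p (x i) = y i" for i
  proof -
    have "i \<in> {- int (nat \<bar>i\<bar> + 1)..<int (n + (nat \<bar>i\<bar> + 1))}" by auto
    then show ?thesis using x(2)[of "nat \<bar>i\<bar> + 1"] unfolding C_def by blast
  qed
  then show "B \<in> lifts UNIV n y" using x unfolding lifts_def C_def by auto
qed (use lifts_mono in blast)

text \<open>The sequence is eventually constant: each of the finitely many blocks that is not a lift
  for \<open>UNIV\<close> drops out at some finite \<open>k\<close>.\<close>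

lemma Z_tendsto: "(\<lambda>k. Z {- int k..<int (n + k)} n y) \<longlonglongrightarrow> Z UNIV n y"
proof (rule tendsto_eventually)
  let ?O = "\<lambda>k. lifts {- int k..<int (n + k)} n y"
  have dec: "?O m \<subseteq> ?O k" if "k \<le> m" for k m using that by (intro lifts_mono) auto
  have "\<forall>B\<in>?O 0 - lifts UNIV n y. \<exists>k. B \<notin> ?O k" using lifts_UNIV_iff by blast
  from bchoice[OF this] obtain k where k: "\<forall>B\<in>?O 0 - lifts UNIV n y. B \<notin> ?O (k B)" ..
  have "finite (k ` (?O 0 - lifts UNIV n y))" using finite_lifts by blast
  then obtain m where m: "\<forall>j\<in>k ` (?O 0 - lifts UNIV n y). j \<le> m"
    using finite_nat_set_iff_bounded_le by blast
  have "?O j = lifts UNIV n y" if j: "m \<le> j" for j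
  proof
    show "lifts UNIV n y \<subseteq> ?O j" by (intro lifts_mono) simp
    show "?O j \<subseteq> lifts UNIV n y"
    proof
      fix B assume B: "B \<in> ?O j"
      show "B \<in> lifts UNIV n y"
      proof (rule ccontr)
        assume "B \<notin> lifts UNIV n y"
        then have B0: "B \<in> ?O 0 - lifts UNIV n y" using B dec[of 0 j] by blast
        then have "k B \<le> m" using m by blast
        then have "k B \<le> j" using j by linarith
        then show False using B B0 k dec[of "k B" j] by blast
      qed
    qed
  qed
  then show "\<forall>\<^sub>F k in sequentially. Z {- int k..<int (n + k)} n y = Z UNIV n y"
    unfolding eventually_sequentially Z_def by metis
qed

lemma measurable_Z_window: "Z {- int k..<int (n + k)} n \<in> borel_measurable borel"
proof (rule borel_measurable_if_window[of "n + k"])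
  fix x z :: "int \<Rightarrow> 'b"
  assume eq: "\<And>i. i \<in> {- int (n + k)..int (n + k)} \<Longrightarrow> z i = x i"
  have "z i = x i" if "i \<in> {- int k..<int (n + k)}" for i using that by (intro eq) auto
  then have "lifts {- int k..<int (n + k)} n z = lifts {- int k..<int (n + k)} n x"
    unfolding lifts_def by metis
  then show "Z {- int k..<int (n + k)} n z = Z {- int k..<int (n + k)} n x"
    by (simp add: Z_def)
qed

text \<open>Infinitely many coordinates are involved, so measurability is inherited from the windows
  through the pointwise limit.\<close>

lemma measurable_Z_UNIV: "Z UNIV n \<in> borel_measurable borel"
  by (rule borel_measurable_LIMSEQ_real[OF Z_tendsto measurable_Z_window])

section \<open>Relative pressure as a growth rate of block sums\<close>

lemma Z_le_sum_s_inf: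
  assumes "0 < e"
  obtains c where "\<And>I n y. Z I n y \<le> exp (e * real n + c) * (\<Sum>B\<in>lifts I n y. s_inf X f B)"
proof -
  obtain c where c: "\<And>B. cylinder X B \<noteq> {} \<Longrightarrow> s_sup X f B \<le> exp (e * real (length B) + c) * s_inf X f B"
    using s_sup_le_s_inf[OF assms] by blast
  show ?thesis
  proof (rule that[of c])
    fix I n y
    show "Z I n y \<le> exp (e * real n + c) * (\<Sum>B\<in>lifts I n y. s_inf X f B)"
      unfolding Z_def sum_distrib_left
    proof (rule sum_mono)
      fix B assume B: "B \<in> lifts I n y"
      then have "cylinder X B \<noteq> {}" using lifts_cylinder by blast
      from c[OF this] show "s_sup X f B \<le> exp (e * real n + c) * s_inf X f B"
        using lifts_length[OF B] by simp
    qed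
  qed
qed

lemma sum_s_inf_le_Z: "(\<Sum>B\<in>lifts I n y. s_inf X f B) \<le> Z I n y"
  unfolding Z_def
proof (rule sum_mono)
  fix B assume "B \<in> lifts I n y"
  then obtain z where "z \<in> cylinder X B" using lifts_cylinder by blast
  from s_bounds(1,2)[OF this] show "s_inf X f B \<le> s_sup X f B" by linarith
qed

lemma sum_s_inf_pos:
  assumes "y \<in> factor_space" shows "0 < (\<Sum>B\<in>lifts I n y. s_inf X f B)"
proof -
  obtain c where "Z I n y \<le> exp (1 * real n + c) * (\<Sum>B\<in>lifts I n y. s_inf X f B)"
    using Z_le_sum_s_inf[of 1] by (metis zero_less_one)
  then have "0 < exp (1 * real n + c) * (\<Sum>B\<in>lifts I n y. s_inf X f B)"
    using Z_pos[OF assms, of I n] by linarith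
  then show ?thesis by (simp add: zero_less_mult_iff)
qed

text \<open>The constant depends on \<open>e\<close> alone, not on \<open>I\<close>, so the same
  estimate serves both the \<open>Psi\<close> functions and the pressure.\<close>

lemma ln_Z_le_ln_sum_s_inf:
  assumes "0 < e"
  obtains c where "\<And>I n y. y \<in> factor_space \<Longrightarrow>
    ln (Z I n y) \<le> ln (\<Sum>B\<in>lifts I n y. s_inf X f B) + e * real n + c"
proof -
  obtain c where c: "\<And>I n y. Z I n y \<le> exp (e * real n + c) * (\<Sum>B\<in>lifts I n y. s_inf X f B)"
    using Z_le_sum_s_inf[OF assms] by blast
  show ?thesis
  proof (rule that[of c])
    fix I n y assume y: "y \<in> factor_space"
    have "ln (Z I n y) \<le> ln (exp (e * real n + c) * (\<Sum>B\<in>lifts I n y. s_inf X f B))"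
      using c Z_pos[OF y] by (intro ln_mono)
    also have "\<dots> = (e * real n + c) + ln (\<Sum>B\<in>lifts I n y. s_inf X f B)"
      using sum_s_inf_pos[OF y, of I n] by (simp add: ln_mult)
    finally show "ln (Z I n y) \<le> ln (\<Sum>B\<in>lifts I n y. s_inf X f B) + e * real n + c" by simp
  qed
qed

lemma blocks_eq_lifts:
  "{B \<in> blocks X (length (block y 0 n)). map p B = block y 0 n} = lifts {0..<int n} n y"
proof -
  have "map p (block x 0 n) = block y 0 n \<longleftrightarrow> (\<forall>i\<in>{0..<int n}. p (x i) = y i)" for x
  proof -
    have "map p (block x 0 n) = block y 0 n \<longleftrightarrow> (\<forall>k<n. p (x (int k)) = y (int k))"
      by (auto simp: block_def list_eq_iff_nth_eq)
    also have "\<dots> \<longleftrightarrow> (\<forall>i\<in>{0..<int n}. p (x i) = y i)"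
      by (metis atLeastLessThan_iff nonneg_int_cases of_nat_0_le_iff of_nat_less_iff)
    finally show ?thesis .
  qed
  moreover have "blocks X n = {block x 0 n | x. x \<in> X}"
  proof
    show "blocks X n \<subseteq> {block x 0 n | x. x \<in> X}"
    proof
      fix w assume "w \<in> blocks X n"
      then obtain x i where x: "x \<in> X" "block x i n = w" by (auto simp: blocks_def occurs_def)
      then have "w = block (shift_pow i x) 0 n" by (simp add: block_shift_pow)
      then show "w \<in> {block x 0 n | x. x \<in> X}" using x(1) shift_pow_in by blast
    qed
    show "{block x 0 n | x. x \<in> X} \<subseteq> blocks X n"
      unfolding blocks_def occurs_def by fastforce
  qed
  ultimately show ?thesis unfolding lifts_def by auto
qed

lemma Psi_sup_eq: "Psi_sup X p f y = limsup (\<lambda>n. ereal (1 / real n * ln (Z {0..<int n} n y)))"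
  unfolding Psi_sup_def S_sup_def blocks_eq_lifts Z_def ..

lemma Psi_inf_eq_Psi_sup:
  assumes y: "y \<in> factor_space" shows "Psi_inf X p f y = Psi_sup X p f y"
proof (rule antisym)
  let ?s = "\<lambda>n. \<Sum>B\<in>lifts {0..<int n} n y. s_inf X f B"
  have inf: "Psi_inf X p f y = limsup (\<lambda>n. ereal (1 / real n * ln (?s n)))"
    unfolding Psi_inf_def S_inf_def blocks_eq_lifts ..
  show "Psi_sup X p f y \<le> Psi_inf X p f y"
    unfolding Psi_sup_eq inf
  proof (rule limsup_average_mono)
    fix e :: real assume "0 < e"
    then obtain c where "\<And>I n y. y \<in> factor_space \<Longrightarrow>
      ln (Z I n y) \<le> ln (\<Sum>B\<in>lifts I n y. s_inf X f B) + e * real n + c"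
      using ln_Z_le_ln_sum_s_inf by blast
    then show "\<exists>c. \<forall>\<^sub>F n in sequentially. ln (Z {0..<int n} n y) \<le> ln (?s n) + e * real n + c"
      using y by (intro exI[of _ c] always_eventually allI)
  qed
  show "Psi_inf X p f y \<le> Psi_sup X p f y"
    unfolding Psi_sup_eq inf
  proof (rule limsup_average_mono)
    fix e :: real assume e: "0 < e"
    have "ln (?s n) \<le> ln (Z {0..<int n} n y) + e * real n + 0" for n
    proof -
      have "ln (?s n) \<le> ln (Z {0..<int n} n y)"
        using sum_s_inf_le_Z sum_s_inf_pos[OF y] by (intro ln_mono)
      moreover have "0 \<le> e * real n" using e by simp
      ultimately show ?thesis by linarith
    qed
    then show "\<exists>c. \<forall>\<^sub>F n in sequentially. ln (?s n) \<le> ln (Z {0..<int n} n y) + e * real n + c"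
      by (intro exI[of _ 0] always_eventually allI)
  qed
qed

text \<open>Points that agree on \<open>[-q, n + q)\<close> stay closer than \<open>\<delta>\<close>
  for \<open>n\<close> steps, so a separated set injects into the blocks on that window. The centre
  is a lift for \<open>UNIV\<close>; each flank has at most \<open>card A ^ q\<close>
  values.\<close>

lemma separated_sum_le:
  assumes q: "(1/2) ^ q \<le> \<delta>" and n: "1 \<le> n" and sep: "separated n \<delta> E"
    and E: "E \<subseteq> {x \<in> X. \<forall>i. p (x i) = y i}"
  shows "(\<Sum>x\<in>E. exp (\<Sum>i<n. f (shift_pow (int i) x))) \<le> real (card A ^ q * card A ^ q) * Z UNIV n y"
proof -
  define h where "h x = (block x (- int q) q, block x (int n) q, block x 0 n)" for x :: "int \<Rightarrow> 'a"
  let ?L = "{B. set B \<subseteq> A \<and> length B = q}"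
  have inj: "inj_on h E"
  proof (rule inj_onI, rule ccontr)
    fix x x' assume x: "x \<in> E" "x' \<in> E" and eq: "h x = h x'" and ne: "x \<noteq> x'"
    have *: "\<forall>k<q. x (- int q + int k) = x' (- int q + int k)"
      "\<forall>k<q. x (int n + int k) = x' (int n + int k)" "\<forall>k<n. x (0 + int k) = x' (0 + int k)"
      using eq unfolding h_def prod.inject block_eq_iff by blast+
    have xx: "x j = x' j" if j: "- int q \<le> j" "j < int n + int q" for j
    proof -
      consider "j < 0" | "0 \<le> j" "j < int n" | "int n \<le> j" by linarith
      then show ?thesis
      proof cases
        case 1 then show ?thesis using *(1)[rule_format, of "nat (j + int q)"] j by simp
      next
        case 2 then show ?thesis using *(3)[rule_format, of "nat j"] by simp
      next
        case 3 then show ?thesis using *(2)[rule_format, of "nat (j - int n)"] j by simp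
      qed
    qed
    have "seq_dist (shift_pow (int i) x) (shift_pow (int i) x') < \<delta>" if i: "i < n" for i
    proof -
      have "seq_dist (shift_pow (int i) x) (shift_pow (int i) x') < (1/2) ^ q"
        unfolding seq_dist_less_iff shift_pow_def using i by (intro ballI xx) auto
      then show ?thesis using q by linarith
    qed
    then have "Max ((\<lambda>i. seq_dist (shift_pow (int i) x) (shift_pow (int i) x')) ` {..<n}) < \<delta>"
      using n by (subst Max_less_iff) (auto simp: lessThan_empty_iff)
    then show False using sep x ne unfolding separated_def by fastforce
  qed
  have hE: "h ` E \<subseteq> ?L \<times> ?L \<times> lifts UNIV n y"
  proof (rule image_subsetI)
    fix x assume "x \<in> E"
    then have x: "x \<in> X" "\<forall>i. p (x i) = y i" using E by auto
    then have "block x 0 n \<in> lifts UNIV n y" unfolding lifts_def by blast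
    moreover have "block x i q \<in> ?L" for i using set_block[OF range_alphabet[OF x(1)]] by simp
    ultimately show "h x \<in> ?L \<times> ?L \<times> lifts UNIV n y" unfolding h_def by blast
  qed
  have L: "finite ?L" "card ?L = card A ^ q"
    using finite_lists_length_eq card_lists_length_eq finite_alphabet by blast+
  have "(\<Sum>x\<in>E. exp (\<Sum>i<n. f (shift_pow (int i) x))) \<le> (\<Sum>x\<in>E. s_sup X f (block x 0 n))"
  proof (rule sum_mono)
    fix x assume "x \<in> E"
    then have "x \<in> cylinder X (block x 0 n)" using E by (auto simp: cylinder_def)
    from s_bounds(1)[OF this]
    show "exp (\<Sum>i<n. f (shift_pow (int i) x)) \<le> s_sup X f (block x 0 n)" by simp
  qed
  also have "\<dots> = (\<Sum>t\<in>h ` E. s_sup X f (snd (snd t)))"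
    by (subst sum.reindex[OF inj]) (simp add: h_def)
  also have "\<dots> \<le> (\<Sum>t\<in>?L \<times> ?L \<times> lifts UNIV n y. s_sup X f (snd (snd t)))"
  proof (rule sum_mono2)
    show "finite (?L \<times> ?L \<times> lifts UNIV n y)"
      using L(1) finite_lifts by (intro finite_cartesian_product)
    fix t assume "t \<in> ?L \<times> ?L \<times> lifts UNIV n y - h ` E"
    then have "snd (snd t) \<in> lifts UNIV n y" by (simp add: mem_Times_iff)
    then show "0 \<le> s_sup X f (snd (snd t))" by (rule less_imp_le[OF s_sup_lifts_pos])
  qed (rule hE)
  also have "\<dots> = real (card A ^ q * card A ^ q) * Z UNIV n y"
    unfolding Z_def using L(2) by (simp add: sum.Sigma[symmetric] L(1) finite_lifts sum.cartesian_product' mult.assoc)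
  finally show ?thesis .
qed

text \<open>One point of the fibre is chosen over each lift. Distinct blocks differ at some
  \<open>i < n\<close>, and after \<open>i\<close> shifts the points differ at the origin, where
  their distance is at least \<open>(1/2) ^ 0 = 1\<close>.\<close>

lemma separated_sum_ge:
  assumes "\<delta> < 1"
  obtains E where "separated n \<delta> E" "E \<subseteq> {x \<in> X. \<forall>i. p (x i) = y i}"
    "(\<Sum>B\<in>lifts UNIV n y. s_inf X f B) \<le> (\<Sum>x\<in>E. exp (\<Sum>i<n. f (shift_pow (int i) x)))"
proof -
  have "\<forall>B\<in>lifts UNIV n y. \<exists>x. x \<in> X \<and> (\<forall>i. p (x i) = y i) \<and> block x 0 n = B"
    unfolding lifts_def by blast
  from bchoice[OF this] obtain x where
    x: "\<forall>B\<in>lifts UNIV n y. x B \<in> X \<and> (\<forall>i. p (x B i) = y i) \<and> block (x B) 0 n = B" ..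
  have inj: "inj_on x (lifts UNIV n y)"
    by (rule inj_onI) (metis x)
  show ?thesis
  proof (rule that[of "x ` lifts UNIV n y"])
    show "x ` lifts UNIV n y \<subseteq> {x \<in> X. \<forall>i. p (x i) = y i}" using x by blast
    show "separated n \<delta> (x ` lifts UNIV n y)"
      unfolding separated_def
    proof (intro ballI impI)
      fix z z' assume "z \<in> x ` lifts UNIV n y" "z' \<in> x ` lifts UNIV n y" "z \<noteq> z'"
      then have "block z 0 n \<noteq> block z' 0 n" using x by force
      then obtain i where i: "i < n" "z (int i) \<noteq> z' (int i)" by (auto simp: block_eq_iff)
      have "\<not> seq_dist (shift_pow (int i) z) (shift_pow (int i) z') < (1/2) ^ 0"
        unfolding seq_dist_less_iff using i(2) by (auto simp: shift_pow_def)
      then have "\<delta> < seq_dist (shift_pow (int i) z) (shift_pow (int i) z')" using assms by simp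
      then show "\<delta> < Max ((\<lambda>i. seq_dist (shift_pow (int i) z) (shift_pow (int i) z')) ` {..<n})"
        using i(1) by (subst Max_gr_iff) auto
    qed
    have "(\<Sum>B\<in>lifts UNIV n y. s_inf X f B)
        \<le> (\<Sum>B\<in>lifts UNIV n y. exp (\<Sum>i<n. f (shift_pow (int i) (x B))))"
    proof (rule sum_mono)
      fix B assume B: "B \<in> lifts UNIV n y"
      then have "x B \<in> cylinder X B" using x lifts_length[OF B] by (simp add: cylinder_def)
      from s_bounds(2)[OF this] show "s_inf X f B \<le> exp (\<Sum>i<n. f (shift_pow (int i) (x B)))"
        using lifts_length[OF B] by simp
    qed
    then show "(\<Sum>B\<in>lifts UNIV n y. s_inf X f B)
        \<le> (\<Sum>x\<in>x ` lifts UNIV n y. exp (\<Sum>i<n. f (shift_pow (int i) x)))"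
      by (simp add: sum.reindex[OF inj])
  qed
qed

text \<open>The factor \<open>D\<close> depends on \<open>\<delta>\<close> but not on
  \<open>n\<close>, so it does not affect the growth rate.\<close>

lemma limsup_pressure_n:
  assumes one_block: "one_block_map X \<pi> p" and y: "y \<in> factor_space" and \<delta>: "0 < \<delta>" "\<delta> < 1"
  shows "limsup (\<lambda>n. ereal (1 / real n * ln (pressure_n X \<pi> f n \<delta> y))) =
    limsup (\<lambda>n. ereal (1 / real n * ln (Z UNIV n y)))"
proof -
  let ?fib = "{x \<in> X. \<forall>i. p (x i) = y i}" and ?P = "\<lambda>n. pressure_n X \<pi> f n \<delta> y"
  let ?sum = "\<lambda>n E. \<Sum>x\<in>E. exp (\<Sum>i<n. f (shift_pow (int i) x))"
  have "{x \<in> X. \<pi> x = y} = ?fib"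
    using one_block unfolding one_block_map_def by (auto simp: fun_eq_iff)
  then have P: "?P n = (SUP E \<in> {E. separated n \<delta> E \<and> E \<subseteq> ?fib}. ?sum n E)" for n
    by (simp add: pressure_n_def)
  obtain q where q: "(1/2) ^ q < \<delta>" using real_arch_pow_inv[of \<delta> "1/2"] \<delta>(1) by auto
  define D where "D = real (card A ^ q * card A ^ q)"
  have D: "0 < D" unfolding D_def using card_alphabet[OF y] by simp
  have sum_le: "?sum n E \<le> D * Z UNIV n y" if "1 \<le> n" "separated n \<delta> E" "E \<subseteq> ?fib" for n E
    unfolding D_def using separated_sum_le[OF less_imp_le[OF q] that] .
  have le: "?P n \<le> D * Z UNIV n y" if "1 \<le> n" for n
    unfolding P using sum_le[OF that]
    by (intro cSUP_least) (auto simp: separated_def intro!: exI[of _ "{}"])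
  have ge: "(\<Sum>B\<in>lifts UNIV n y. s_inf X f B) \<le> ?P n" if n: "1 \<le> n" for n
  proof -
    obtain E where E: "separated n \<delta> E" "E \<subseteq> ?fib"
      "(\<Sum>B\<in>lifts UNIV n y. s_inf X f B) \<le> ?sum n E"
      using separated_sum_ge[OF \<delta>(2)] by blast
    \<comment> \<open>A real supremum bounds its members only if the family is bounded
      above.\<close>
    have "bdd_above (?sum n ` {E. separated n \<delta> E \<and> E \<subseteq> ?fib})"
      using sum_le[OF n] by (intro bdd_aboveI2[of _ _ "D * Z UNIV n y"]) blast
    then have "?sum n E \<le> ?P n" unfolding P using E(1,2) by (intro cSUP_upper) blast
    then show ?thesis using E(3) by linarith
  qed
  show ?thesis
  proof (rule antisym)
    show "limsup (\<lambda>n. ereal (1 / real n * ln (?P n))) \<le> limsup (\<lambda>n. ereal (1 / real n * ln (Z UNIV n y)))"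
    proof (rule limsup_average_mono)
      fix e :: real assume e: "0 < e"
      have "ln (?P n) \<le> ln (Z UNIV n y) + e * real n + ln D" if n: "1 \<le> n" for n
      proof -
        have "0 < ?P n" using ge[OF n] sum_s_inf_pos[OF y, of UNIV n] by linarith
        then have "ln (?P n) \<le> ln (D * Z UNIV n y)" using le[OF n] by (intro ln_mono)
        also have "\<dots> = ln D + ln (Z UNIV n y)" using D Z_pos[OF y, of UNIV n] by (simp add: ln_mult)
        finally show ?thesis using mult_nonneg_nonneg[of e "real n"] e by linarith
      qed
      then show "\<exists>c. \<forall>\<^sub>F n in sequentially. ln (?P n) \<le> ln (Z UNIV n y) + e * real n + c"
        unfolding eventually_sequentially by blast
    qed
    show "limsup (\<lambda>n. ereal (1 / real n * ln (Z UNIV n y))) \<le> limsup (\<lambda>n. ereal (1 / real n * ln (?P n)))"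
    proof (rule limsup_average_mono)
      fix e :: real assume "0 < e"
      then obtain c where c: "\<And>I n y. y \<in> factor_space \<Longrightarrow>
        ln (Z I n y) \<le> ln (\<Sum>B\<in>lifts I n y. s_inf X f B) + e * real n + c"
        using ln_Z_le_ln_sum_s_inf by blast
      have "ln (Z UNIV n y) \<le> ln (?P n) + e * real n + c" if n: "1 \<le> n" for n
      proof -
        have "ln (\<Sum>B\<in>lifts UNIV n y. s_inf X f B) \<le> ln (?P n)"
          using ge[OF n] sum_s_inf_pos[OF y] by (intro ln_mono)
        then show ?thesis using c[OF y, of UNIV n] by linarith
      qed
      then show "\<exists>c. \<forall>\<^sub>F n in sequentially. ln (Z UNIV n y) \<le> ln (?P n) + e * real n + c"
        unfolding eventually_sequentially by blast
    qed
  qed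
qed

text \<open>The expression under the limit is constant for \<open>\<delta>\<close> between 0 and
  1.\<close>

lemma rel_pressure_eq:
  assumes "one_block_map X \<pi> p" "y \<in> factor_space"
  shows "rel_pressure X \<pi> f y = limsup (\<lambda>n. ereal (1 / real n * ln (Z UNIV n y)))"
  unfolding rel_pressure_def
proof (rule tendsto_Lim)
  have "\<forall>\<^sub>F \<delta> in at_right (0::real). 0 < \<delta> \<and> \<delta> < 1"
    using eventually_at_right_real[of 0 1] by (rule eventually_mono) simp_all
  then show "((\<lambda>\<delta>. limsup (\<lambda>n. ereal (1 / real n * ln (pressure_n X \<pi> f n \<delta> y)))) \<longlongrightarrow>
      limsup (\<lambda>n. ereal (1 / real n * ln (Z UNIV n y)))) (at_right 0)"
    by (intro tendsto_eventually, elim eventually_mono) (intro limsup_pressure_n[OF assms], auto)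
qed simp

section \<open>Almost everywhere equality\<close>

lemma average_ln_Z_bound:
  assumes "y \<in> factor_space"
  shows "\<bar>1 / real n * ln (Z I n y)\<bar> \<le> rate"
proof (cases "n = 0")
  case False
  then show ?thesis using ln_Z_bounds(2)[OF assms, of I n] by (simp add: abs_mult field_simps)
qed (use rate_nonneg[OF assms] in simp)

text \<open>By \<open>Psi_sup_eq\<close> and \<open>rel_pressure_eq\<close>, \<open>U\<close> is the
  common value of the \<open>Psi\<close> functions and \<open>V\<close> the relative pressure.
  Uniform boundedness by \<open>rate\<close> makes all the integrals finite.\<close>

lemma AE_limsup_eq:
  assumes \<nu>: "prob_space \<nu>" and sets: "sets \<nu> = sets (restrict_space borel factor_space)"
    and T: "shift \<in> measurable \<nu> \<nu>" "distr \<nu> \<nu> shift = \<nu>"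
  defines "U \<equiv> \<lambda>y. limsup (\<lambda>n. ereal (1 / real n * ln (Z {0..<int n} n y)))"
    and "V \<equiv> \<lambda>y. limsup (\<lambda>n. ereal (1 / real n * ln (Z UNIV n y)))"
  shows "AE y in \<nu>. V y = U y"
    and "integrable \<nu> (\<lambda>y. real_of_ereal (U y))" and "integrable \<nu> (\<lambda>y. real_of_ereal (V y))"
    and "\<And>y. y \<in> space \<nu> \<Longrightarrow> \<bar>V y\<bar> \<noteq> \<infinity>"
proof -
  interpret prob_space \<nu> by (fact \<nu>)
  have space: "space \<nu> = factor_space"
    using sets_eq_imp_space_eq[OF sets] by (simp add: space_restrict_space)
  have meas: "h \<in> borel_measurable \<nu>" if "h \<in> borel_measurable borel" for h :: "(int \<Rightarrow> 'b) \<Rightarrow> real"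
    unfolding measurable_cong_sets[OF sets refl] using that by (rule measurable_restrict_space1)
  have Zm [measurable]: "Z {- int k..<int (n + k)} n \<in> borel_measurable \<nu>" "Z UNIV n \<in> borel_measurable \<nu>" for k n
    by (intro meas measurable_Z_window measurable_Z_UNIV)+
  have Zm0 [measurable]: "Z {0..<int n} n \<in> borel_measurable \<nu>" for n
    using meas[OF measurable_Z_window[of 0 n]] by simp
  have U_meas: "(\<lambda>y. real_of_ereal (U y)) \<in> borel_measurable \<nu>"
    and V_meas: "(\<lambda>y. real_of_ereal (V y)) \<in> borel_measurable \<nu>"
    unfolding U_def V_def by measurable
  note bd = average_ln_Z_bound[folded space]
  have U_fin: "\<bar>U y\<bar> \<noteq> \<infinity>" and U_bd: "\<bar>real_of_ereal (U y)\<bar> \<le> rate"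
    and V_fin: "\<bar>V y\<bar> \<noteq> \<infinity>" and V_bd: "\<bar>real_of_ereal (V y)\<bar> \<le> rate" if "y \<in> space \<nu>" for y
  proof -
    have "\<forall>\<^sub>F n in sequentially. \<bar>1 / real n * ln (Z {0..<int n} n y)\<bar> \<le> rate"
      "\<forall>\<^sub>F n in sequentially. \<bar>1 / real n * ln (Z UNIV n y)\<bar> \<le> rate"
      by (intro always_eventually allI bd[OF that])+
    note limsup_bounded_real[OF this(1)] limsup_bounded_real[OF this(2)]
    then show "\<bar>U y\<bar> \<noteq> \<infinity>" "\<bar>real_of_ereal (U y)\<bar> \<le> rate"
      "\<bar>V y\<bar> \<noteq> \<infinity>" "\<bar>real_of_ereal (V y)\<bar> \<le> rate"
      unfolding U_def V_def by blast+
  qed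
  show "\<And>y. y \<in> space \<nu> \<Longrightarrow> \<bar>V y\<bar> \<noteq> \<infinity>" by (rule V_fin)
  show U_int: "integrable \<nu> (\<lambda>y. real_of_ereal (U y))"
    by (rule integrable_const_bound[OF AE_I2 U_meas]) (unfold real_norm_def, rule U_bd)
  show V_int: "integrable \<nu> (\<lambda>y. real_of_ereal (V y))"
    by (rule integrable_const_bound[OF AE_I2 V_meas]) (unfold real_norm_def, rule V_bd)
  have Tn: "shift_pow (int n) \<in> measurable \<nu> \<nu>" "distr \<nu> \<nu> (shift_pow (int n)) = \<nu>" for n
    unfolding shift_pow_of_nat using distr_funpow_invariant[OF T, of n] by auto
  have window: "(\<integral>y. real_of_ereal (U y) \<partial>\<nu>) \<le> (\<integral>y. 1 / real n * ln (Z {- int k..<int (n + k)} n y) \<partial>\<nu>)"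
    if n: "1 \<le> n" for n k
  proof -
    let ?w = "\<lambda>y. 1 / real n * ln (Z {- int k..<int (n + k)} n y)"
    \<comment> \<open>The blocks in \<open>ln_Z_window\<close> start at \<open>k + l * n\<close>:
      the orbit runs under the \<open>n\<close>-th power of the shift, and the offset
      \<open>k\<close> is absorbed into the observable.\<close>
    let ?g = "\<lambda>y. ?w (shift_pow (int k) y)"
    let ?L = "\<lambda>y. real_of_ereal (limsup (\<lambda>q. ereal (1 / real q * (\<Sum>l<q. ?g ((shift_pow (int n) ^^ l) y)))))"
    have w_meas: "?w \<in> borel_measurable \<nu>" by measurable
    then have g_meas: "?g \<in> borel_measurable \<nu>" using Tn(1) by (rule measurable_compose_rev)
    have g_bd: "\<bar>?g y\<bar> \<le> rate" if "y \<in> space \<nu>" for y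
      using bd factor_space_shift_pow[folded space, OF that] by blast
    note avg = integral_limsup_average_le[OF Tn g_meas g_bd]
    have "(\<integral>y. real_of_ereal (U y) \<partial>\<nu>) \<le> (\<integral>y. ?L y \<partial>\<nu>)"
    proof (rule integral_mono[OF U_int avg(1)])
      fix y assume y: "y \<in> space \<nu>"
      let ?gl = "\<lambda>l. ?g ((shift_pow (int n) ^^ l) y)"
      have gl_bd: "\<bar>?gl l\<bar> \<le> rate" for l
        unfolding shift_pow_funpow using g_bd factor_space_shift_pow[folded space, OF y] by blast
      have "U y \<le> limsup (\<lambda>q. ereal (1 / real q * (\<Sum>l<q. ?gl l)))"
        unfolding U_def
      proof (rule limsup_block_average[OF _ gl_bd, where d = "2 * k" and c = "real (2 * k + n) * rate"])
        fix q r assume r: "r < n"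
        have "ln (Z {0..<int (2 * k + q * n + r)} (2 * k + q * n + r) y) \<le>
            (\<Sum>l<q. ln (Z {- int k..<int (n + k)} n (shift_pow (int (l * n) + int k) y)))
            + real (2 * k + r) * rate"
          using ln_Z_window y space by blast
        also have "(\<Sum>l<q. ln (Z {- int k..<int (n + k)} n (shift_pow (int (l * n) + int k) y))) =
            real n * (\<Sum>l<q. ?gl l)"
          using n by (simp add: shift_pow_funpow shift_pow_add sum_distrib_left add.commute)
        also have "real (2 * k + r) * rate \<le> real (2 * k + n) * rate"
          using r rate_nonneg[folded space, OF y] by (intro mult_right_mono) auto
        finally show "ln (Z {0..<int (2 * k + q * n + r)} (2 * k + q * n + r) y)
            \<le> real n * (\<Sum>l<q. ?gl l) + real (2 * k + n) * rate" by simp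
      qed (use n in simp)
      moreover have "\<bar>limsup (\<lambda>q. ereal (1 / real q * (\<Sum>l<q. ?gl l)))\<bar> \<noteq> \<infinity>"
        using gl_bd by (intro limsup_bounded_real(1)[of _ "\<bar>rate\<bar>"] always_eventually allI
            average_bound abs_sum_le_bound)
      ultimately show "real_of_ereal (U y) \<le> ?L y"
        using U_fin[OF y] by (intro real_of_ereal_mono_finite)
    qed
    also have "\<dots> \<le> (\<integral>y. ?g y \<partial>\<nu>)" by (rule avg(2))
    \<comment> \<open>Invariance of \<open>\<nu>\<close> removes the offset
      \<open>k\<close>.\<close>
    also have "\<dots> = (\<integral>y. ?w y \<partial>\<nu>)"
      using integral_distr[OF Tn(1)[of k] w_meas, unfolded Tn(2)] by (rule sym)
    finally show ?thesis .
  qed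
  have fiber: "(\<integral>y. real_of_ereal (U y) \<partial>\<nu>) \<le> (\<integral>y. 1 / real n * ln (Z UNIV n y) \<partial>\<nu>)" if n: "1 \<le> n" for n
  proof (rule LIMSEQ_le_const)
    show "(\<lambda>k. \<integral>y. 1 / real n * ln (Z {- int k..<int (n + k)} n y) \<partial>\<nu>)
        \<longlonglongrightarrow> (\<integral>y. 1 / real n * ln (Z UNIV n y) \<partial>\<nu>)"
    proof (rule integral_dominated_convergence[where w = "\<lambda>_. rate"])
      show "AE y in \<nu>. (\<lambda>k. 1 / real n * ln (Z {- int k..<int (n + k)} n y)) \<longlonglongrightarrow> 1 / real n * ln (Z UNIV n y)"
      proof (rule AE_I2)
        fix y assume "y \<in> space \<nu>"
        then have "Z UNIV n y \<noteq> 0" using Z_pos[folded space, of y UNIV n] by simp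
        then show "(\<lambda>k. 1 / real n * ln (Z {- int k..<int (n + k)} n y)) \<longlonglongrightarrow> 1 / real n * ln (Z UNIV n y)"
          by (intro tendsto_intros Z_tendsto)
      qed
      show "AE y in \<nu>. norm (1 / real n * ln (Z {- int k..<int (n + k)} n y)) \<le> rate" for k
        using bd by (intro AE_I2) (simp only: real_norm_def)
    qed measurable
    show "\<exists>N. \<forall>k\<ge>N. (\<integral>y. real_of_ereal (U y) \<partial>\<nu>) \<le> (\<integral>y. 1 / real n * ln (Z {- int k..<int (n + k)} n y) \<partial>\<nu>)"
      using window[OF n] by blast
  qed
  \<comment> \<open>The integral of \<open>U\<close> is itself the constant lower bound
    \<open>c\<close> in the reverse Fatou lemma, valid for every \<open>n \<ge> 1\<close> by
    \<open>fiber\<close>.\<close>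
  have UV: "(\<integral>y. real_of_ereal (U y) \<partial>\<nu>) \<le> (\<integral>y. real_of_ereal (V y) \<partial>\<nu>)"
    unfolding V_def by (rule le_integral_limsup[OF _ bd fiber]) measurable
  have VU: "V y \<le> U y" if y: "y \<in> space \<nu>" for y
    unfolding U_def V_def
  proof (intro Limsup_mono always_eventually allI)
    fix n
    have "ln (Z UNIV n y) \<le> ln (Z {0..<int n} n y)"
      using Z_mono[of "{0..<int n}" UNIV] Z_pos[folded space, OF y] by (intro ln_mono) auto
    then show "ereal (1 / real n * ln (Z UNIV n y)) \<le> ereal (1 / real n * ln (Z {0..<int n} n y))"
      by (simp add: divide_right_mono)
  qed
  have nonneg: "0 \<le> real_of_ereal (U y) - real_of_ereal (V y)" if "y \<in> space \<nu>" for y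
    using VU[OF that] U_fin[OF that] V_fin[OF that] by (cases "U y"; cases "V y") auto
  have "0 \<le> (\<integral>y. real_of_ereal (U y) - real_of_ereal (V y) \<partial>\<nu>)"
    using nonneg by (intro integral_nonneg_AE AE_I2)
  then have "(\<integral>y. real_of_ereal (U y) - real_of_ereal (V y) \<partial>\<nu>) = 0"
    using UV U_int V_int by simp
  moreover have "integrable \<nu> (\<lambda>y. real_of_ereal (U y) - real_of_ereal (V y))"
    using U_int V_int by simp
  ultimately have "AE y in \<nu>. real_of_ereal (U y) - real_of_ereal (V y) = 0"
    using nonneg integral_nonneg_eq_0_iff_AE[of \<nu> "\<lambda>y. real_of_ereal (U y) - real_of_ereal (V y)"]
    by (simp add: AE_I2)
  then show "AE y in \<nu>. V y = U y"
    using AE_space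
  proof eventually_elim
    case (elim y)
    then show ?case using U_fin[of y] V_fin[of y] by (cases "U y"; cases "V y") auto
  qed
qed

end

section \<open>From block sums to the pressure and the \<open>Psi\<close> functions\<close>

theorem theorem2:
  fixes A :: "'a::discrete_topology set" and B :: "'b::discrete_topology set"
    and X :: "(int \<Rightarrow> 'a) set" and Y :: "(int \<Rightarrow> 'b) set"
    and \<pi> :: "(int \<Rightarrow> 'a) \<Rightarrow> int \<Rightarrow> 'b" and p :: "'a \<Rightarrow> 'b"
    and f :: "(int \<Rightarrow> 'a) \<Rightarrow> real" and \<nu> :: "(int \<Rightarrow> 'b) measure"
  assumes "shift_of_finite_type A X" and "irreducible_shift X"
    and "subshift B Y"
    and "factor_map X Y \<pi>" and "one_block_map X \<pi> p"
    and "continuous_on X f"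
    and "\<nu> \<in> invariant_measures Y"
  shows "(AE y in \<nu>. rel_pressure X \<pi> f y = Psi_inf X p f y \<and> Psi_inf X p f y = Psi_sup X p f y) \<and>
    (AE y in \<nu>. \<bar>rel_pressure X \<pi> f y\<bar> \<noteq> \<infinity>) \<and>
    integrable \<nu> (\<lambda>y. real_of_ereal (rel_pressure X \<pi> f y)) \<and>
    integrable \<nu> (\<lambda>y. real_of_ereal (Psi_inf X p f y)) \<and>
    integrable \<nu> (\<lambda>y. real_of_ereal (Psi_sup X p f y)) \<and>
    (\<integral>y. real_of_ereal (rel_pressure X \<pi> f y) \<partial>\<nu>) = (\<integral>y. real_of_ereal (Psi_inf X p f y) \<partial>\<nu>) \<and>
    (\<integral>y. real_of_ereal (Psi_inf X p f y) \<partial>\<nu>) = (\<integral>y. real_of_ereal (Psi_sup X p f y) \<partial>\<nu>)"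
proof -
  have sub: "subshift A X" using assms(1) by (rule shift_of_finite_type_subshift)
  have "compact (f ` X)" using subshift_compact[OF sub] assms(6) by (intro compact_continuous_image)
  then obtain K0 where "\<forall>t\<in>f ` X. norm t \<le> K0" using compact_imp_bounded bounded_iff by metis
  then have K0: "\<And>x. x \<in> X \<Longrightarrow> \<bar>f x\<bar> \<le> \<bar>K0\<bar>" by fastforce
  \<comment> \<open>The absolute value makes the bound nonnegative even if \<open>X\<close> is
    empty.\<close>
  interpret subshift_potential A X p f "\<bar>K0\<bar>"
    by unfold_locales (use sub assms(6) K0 in auto)
  have "\<pi> x = (\<lambda>i. p (x i))" if "x \<in> X" for x
    using assms(5) that by (simp add: one_block_map_def fun_eq_iff)
  then have Y: "Y = factor_space"
    using assms(4) unfolding factor_map_def factor_space_def by force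
  have \<nu>: "prob_space \<nu>" "sets \<nu> = sets (restrict_space borel factor_space)"
    "shift \<in> measurable \<nu> \<nu>" "distr \<nu> \<nu> shift = \<nu>"
    using assms(7) unfolding invariant_measures_def Y by auto
  have space: "y \<in> factor_space" if "y \<in> space \<nu>" for y
    using that sets_eq_imp_space_eq[OF \<nu>(2)] by (simp add: space_restrict_space)
  have P: "rel_pressure X \<pi> f y = limsup (\<lambda>n. ereal (1 / real n * ln (Z UNIV n y)))"
    and I: "Psi_inf X p f y = limsup (\<lambda>n. ereal (1 / real n * ln (Z {0..<int n} n y)))"
    if "y \<in> space \<nu>" for y
    using rel_pressure_eq[OF assms(5) space[OF that]] Psi_inf_eq_Psi_sup[OF space[OF that]] Psi_sup_eq
    by auto
  note main = AE_limsup_eq[OF \<nu>]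
  have ae: "AE y in \<nu>. rel_pressure X \<pi> f y = Psi_inf X p f y \<and> Psi_inf X p f y = Psi_sup X p f y"
    using main(1) AE_space by eventually_elim (simp add: P I Psi_sup_eq)
  have fin: "AE y in \<nu>. \<bar>rel_pressure X \<pi> f y\<bar> \<noteq> \<infinity>"
    using main(4) by (intro AE_I2) (simp add: P)
  have int: "integrable \<nu> (\<lambda>y. real_of_ereal (rel_pressure X \<pi> f y))"
    "integrable \<nu> (\<lambda>y. real_of_ereal (Psi_inf X p f y))"
    "integrable \<nu> (\<lambda>y. real_of_ereal (Psi_sup X p f y))"
    using main(2,3) by (simp_all add: P I Psi_sup_eq cong: Bochner_Integration.integrable_cong)
  have "(\<integral>y. real_of_ereal (rel_pressure X \<pi> f y) \<partial>\<nu>) = (\<integral>y. real_of_ereal (Psi_inf X p f y) \<partial>\<nu>)"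
    by (rule integral_cong_AE) (use int ae in auto)
  \<comment> \<open>These two functions agree at every point of the space, so plain congruence
    suffices; the pressure agrees with them only almost everywhere.\<close>
  moreover have "(\<integral>y. real_of_ereal (Psi_inf X p f y) \<partial>\<nu>) = (\<integral>y. real_of_ereal (Psi_sup X p f y) \<partial>\<nu>)"
    by (rule Bochner_Integration.integral_cong) (simp_all add: I Psi_sup_eq)
  ultimately show ?thesis using ae fin int by blast
qed

end
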